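(* Let $n>0$, $x>0$, $\delta\in\mathbb R$ and $y=x^2/(n+x^2)$, so $0<y<1$. Then $$F_n(x;\delta)=\tfrac12\operatorname{erfc}\left(\delta/\sqrt2\right)+\tfrac12e^{-\frac12\delta^2}\frac{\sqrt{y}\,(1-y)^{\frac12n}}{2\pi i}\int_0^{(1+)}e^{\frac12\delta^2 y\tau}\,\frac{\tau^{\frac12n-\frac12}\operatorname{erfc}\left(-\delta\sqrt{\frac12 y\tau}\right)}{(\tau-1)^{\frac12n}(1-y\tau)}\,d\tau$$ and $$F_n(x;\delta)=1-\tfrac12e^{-\frac12\delta^2}\frac{\sqrt{y}\,(1-y)^{\frac12n}}{2\pi i}\int_0^{(1+,\,1/y+)}e^{\frac12\delta^2 y\tau}\,\frac{\tau^{\frac12n-\frac12}\operatorname{erfc}\left(-\delta\sqrt{\frac12 y\tau}\right)}{(\tau-1)^{\frac12n}(y\tau-1)}\,d\tau .$$ The first contour is finite, starts at the origin, encircles $\tau=1$ once anti-clockwise, and returns to the origin, cutting the positive real axis between $1$ and $1/y$ (so that the pole $\tau=1/y$ is outside). The second contour starts at the origin, encircles both $\tau=1$ and $\tau=1/y$ once anti-clockwise, and returns to the origin. Multivalued factors assume their principal values, with $\tau-1$ positive for $\tau>1$.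
   Context: Notation. $\operatorname{erfc}(z)=\frac{2}{\sqrt\pi}\int_z^\infty e^{-t^2}dt$ (an entire function). $I_y(a,b)=\frac{1}{B(a,b)}\int_0^y t^{a-1}(1-t)^{b-1}dt$ is the normalized incomplete beta function, with $B(a,b)=\Gamma(a)\Gamma(b)/\Gamma(a+b)$. For $x\ge 0$, $\delta\in\mathbb R$, $n>0$ (not necessarily an integer), with $y=x^2/(n+x^2)$, the noncentral $t$-distribution is $$F_n(x;\delta)=\tfrac12\operatorname{erfc}\left(\delta/\sqrt2\right)+P_n(x;\delta)+Q_n(x;\delta),$$ $$P_n(x;\delta)=\tfrac12 e^{-\frac12\delta^2}\sum_{j=0}^\infty \frac{(\frac12\delta^2)^j}{j!}\, I_y\left(j+\tfrac12,\tfrac12 n\right),\qquad Q_n(x;\delta)=\tfrac12 e^{-\frac12\delta^2}\sum_{j=0}^\infty \frac{\delta}{\sqrt2}\frac{(\frac12\delta^2)^j}{\Gamma(j+\frac32)}\, I_y\left(j+1,\tfrac12 n\right).$$ The contours, apart from their endpoints at $0$, stay off the branch cut $(-\infty,1]$ of the principal branches; they leave the origin in the lower half-plane and return to it from the upper half-plane. *)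

theory Defs
  imports "HOL-Complex_Analysis.Complex_Analysis"
begin

text \<open>The integral from \<open>z\<close> to \<open>\<infinity>\<close> is taken along the horizontal ray \<open>z + s\<close>, \<open>s \<ge> 0\<close>.
  The definition is used both on the reals and on the complex numbers.\<close>
definition erfc :: "'a::{real_normed_field,banach} \<Rightarrow> 'a" where
  "erfc z = of_real (2 / sqrt pi) * integral {0..} (\<lambda>s::real. exp (- ((z + of_real s)\<^sup>2)))"

definition inc_beta :: "real \<Rightarrow> real \<Rightarrow> real \<Rightarrow> real" where
  "inc_beta y a b = 1 / Beta a b * integral {0..y} (\<lambda>t. t powr (a - 1) * (1 - t) powr (b - 1))"

definition nct_P :: "real \<Rightarrow> real \<Rightarrow> real \<Rightarrow> real" where
  "nct_P n x \<delta> = (let y = x\<^sup>2 / (n + x\<^sup>2) in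
     1/2 * exp (- (\<delta>\<^sup>2 / 2)) *
       (\<Sum>j. (\<delta>\<^sup>2 / 2) ^ j / fact j * inc_beta y (real j + 1/2) (n/2)))"

definition nct_Q :: "real \<Rightarrow> real \<Rightarrow> real \<Rightarrow> real" where
  "nct_Q n x \<delta> = (let y = x\<^sup>2 / (n + x\<^sup>2) in
     1/2 * exp (- (\<delta>\<^sup>2 / 2)) *
       (\<Sum>j. \<delta> / sqrt 2 * ((\<delta>\<^sup>2 / 2) ^ j / Gamma (real j + 3/2)) * inc_beta y (real j + 1) (n/2)))"

text \<open>The noncentral \<open>t\<close>-distribution with \<open>n > 0\<close> degrees of freedom and noncentrality
  parameter \<open>\<delta>\<close>; the formula is meant for \<open>x \<ge> 0\<close> only.\<close>
definition nct_F :: "real \<Rightarrow> real \<Rightarrow> real \<Rightarrow> real" where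
  "nct_F n x \<delta> = 1/2 * erfc (\<delta> / sqrt 2) + nct_P n x \<delta> + nct_Q n x \<delta>"

text \<open>On the principal branches, \<open>powr\<close> and \<open>csqrt\<close> make this holomorphic off \<open>(-\<infinity>, 1]\<close>.\<close>
definition nct_kernel :: "real \<Rightarrow> real \<Rightarrow> real \<Rightarrow> complex \<Rightarrow> complex" where
  "nct_kernel n \<delta> y \<tau> =
     exp (of_real (\<delta>\<^sup>2 / 2 * y) * \<tau>) *
     (\<tau> powr of_real (n/2 - 1/2) * erfc (- of_real \<delta> * csqrt (of_real (y/2) * \<tau>))) /
     (\<tau> - 1) powr of_real (n/2)"

definition loop_around_1 :: "(real \<Rightarrow> complex) \<Rightarrow> bool" where
  "loop_around_1 \<gamma> \<longleftrightarrow>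
     valid_path \<gamma> \<and> pathstart \<gamma> = 0 \<and> pathfinish \<gamma> = 0 \<and>
     (\<forall>t\<in>{0<..<1}. \<gamma> t \<notin> complex_of_real ` {..1}) \<and>
     (\<forall>\<^sub>F t in at_right 0. Im (\<gamma> t) < 0) \<and>
     (\<forall>\<^sub>F t in at_left 1. Im (\<gamma> t) > 0) \<and>
     winding_number \<gamma> 1 = 1"

text \<open>The contour \<open>(1+)\<close>. Since the winding numbers about \<open>1\<close> and \<open>1/y\<close> differ, \<open>\<gamma>\<close>
  necessarily cuts the positive real axis between these two points.\<close>
definition contour_1 :: "real \<Rightarrow> (real \<Rightarrow> complex) \<Rightarrow> bool" where
  "contour_1 y \<gamma> \<longleftrightarrow> loop_around_1 \<gamma> \<and>
     complex_of_real (1/y) \<notin> path_image \<gamma> \<and> winding_number \<gamma> (complex_of_real (1/y)) = 0"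

text \<open>The contour \<open>(1+, 1/y+)\<close>.\<close>
definition contour_1_inv :: "real \<Rightarrow> (real \<Rightarrow> complex) \<Rightarrow> bool" where
  "contour_1_inv y \<gamma> \<longleftrightarrow> loop_around_1 \<gamma> \<and>
     complex_of_real (1/y) \<notin> path_image \<gamma> \<and> winding_number \<gamma> (complex_of_real (1/y)) = 1"

end

theory Submission
  imports Defs "HOL-Probability.Distributions"
begin

text \<open>
  The integrand is holomorphic on the plane slit along \<open>(-\<infinity>, 1]\<close> except for a simple pole at \<open>1/y\<close>. After
  subtracting the pole part it has a primitive there, whose one-sided limits at the origin exist; hence
  the integral over any admissible loop is the difference of these limits plus \<open>2 \<pi> i\<close> times the residue times
  the winding number about \<open>1/y\<close>. The residue accounts for the difference between the two formulas,
  by \<open>erfc z + erfc (-z) = 2\<close>.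

  The difference of the limits is computed on one contour inside \<open>|\<tau>| < 1/y\<close>, with \<open>\<tau> = s\<^sup>2\<close> so that the
  integrand is continuous up to the origin. There \<open>exp (z\<^sup>2) erfc (-z) = \<Sum>k. z\<^sup>k / \<Gamma>(k/2 + 1)\<close> may be
  integrated term by term, and each term is an incomplete beta function
  \<open>I\<^sub>y(p, q) = y\<^sup>p (1 - y)\<^sup>q / (2 \<pi> i) * \<integral> \<tau> powr (p + q - 1) * (\<tau> - 1) powr (- q) / (1 - y \<tau>) d\<tau>\<close>.
\<close>

section \<open>Loop integrals from boundary values of primitives\<close>

text \<open>For \<open>n < 1\<close> the integrand is unbounded at the origin, where the loop both
  starts and ends, so a deformation of the contour would have to control the way in which it gets
  there. The one-sided limits of a primitive avoid this. The substitution
  \<open>\<tau> = s^2\<close> turns the exponent \<open>n/2 - 1/2\<close> into \<open>n > 0\<close>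
  and makes the square root inside \<open>erfc\<close> linear on the right half-plane. The
  parameters of the beta integrals are then forced, with \<open>q = n/2\<close> throughout. Even
  powers of \<open>z\<close> contribute \<open>\<tau>^j\<close>, that is \<open>p = j + 1/2\<close>,
  and give \<open>nct_P\<close>; odd powers contribute a further \<open>sqrt \<tau>\<close>, that is
  \<open>p = j + 1\<close>, and give \<open>nct_Q\<close>. The explicit contour must enclose
  \<open>1\<close> and yet stay inside the disc where \<open>1 / (1 - y * \<tau>)\<close> has its
  geometric expansion; \<open>1 < 1/y\<close> leaves room for it. Term by term, the loop integral
  and the recurrence of the incomplete beta function in \<open>p\<close> produce the same
  coefficient \<open>Gamma (p + q) / (Gamma q * Gamma (p + 1))\<close>.\<close>

lemma has_contour_integral_primitive_limits:
  fixes \<gamma> :: "real \<Rightarrow> complex"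
  assumes \<gamma>: "valid_path \<gamma>" and U: "\<And>t. 0 < t \<Longrightarrow> t < 1 \<Longrightarrow> \<gamma> t \<in> U"
    and der: "\<And>z. z \<in> U \<Longrightarrow> (G has_field_derivative f z) (at z)"
    and l0: "((\<lambda>t. G (\<gamma> t)) \<longlongrightarrow> l0) (at_right 0)"
    and l1: "((\<lambda>t. G (\<gamma> t)) \<longlongrightarrow> l1) (at_left 1)"
  shows "(f has_contour_integral (l1 - l0)) \<gamma>"
proof -
  obtain S where cont: "continuous_on {0..1} \<gamma>" and fin: "finite S"
    and C1: "\<gamma> C1_differentiable_on {0..1} - S"
    using \<gamma> by (auto simp: valid_path_def piecewise_C1_differentiable_on_def)
  \<comment> \<open>The limits serve as endpoint values because \<open>G\<close> need not be
    continuous at \<open>\<gamma> 0\<close> and \<open>\<gamma> 1\<close>. The fundamental theorem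
    then asks for derivatives only in the open interval.\<close>
  define F where "F = (\<lambda>t. if t = 0 then l0 else if t = 1 then l1 else G (\<gamma> t))"
  have ev0: "\<forall>\<^sub>F t in at_right 0. F t = G (\<gamma> t)"
    unfolding F_def eventually_at by (rule exI[of _ 1]) (auto simp: dist_real_def)
  have ev1: "\<forall>\<^sub>F t in at_left 1. F t = G (\<gamma> t)"
    unfolding F_def eventually_at by (rule exI[of _ 1]) (auto simp: dist_real_def)
  have contF: "continuous_on {0..1} F"
  proof (rule continuous_on_IccI)
    show "(F \<longlongrightarrow> F 0) (at_right 0)"
      using l0 tendsto_cong[OF ev0] by (simp add: F_def)
    show "(F \<longlongrightarrow> F 1) (at_left 1)"
      using l1 tendsto_cong[OF ev1] by (simp add: F_def)
    show "F \<midarrow>t\<rightarrow> F t" if t: "0 < t" "t < 1" for t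
    proof -
      have "isCont \<gamma> t"
        using cont t by (simp add: continuous_on_interior interior_atLeastAtMost_real)
      moreover have "isCont G (\<gamma> t)"
        using der[OF U[OF t]] by (rule DERIV_isCont)
      ultimately have "isCont (\<lambda>t. G (\<gamma> t)) t"
        by (rule isCont_o2)
      moreover have "\<forall>\<^sub>F u in nhds t. u \<in> {0<..<1}"
        using t by (intro eventually_nhds_in_open) auto
      then have "\<forall>\<^sub>F u in nhds t. F u = G (\<gamma> u)"
        by eventually_elim (auto simp: F_def)
      ultimately have "isCont F t"
        using isCont_cong[of F "\<lambda>u. G (\<gamma> u)" t] by simp
      then show ?thesis by (simp add: isCont_def)
    qed
  qed simp
  have "((\<lambda>t. f (\<gamma> t) * vector_derivative \<gamma> (at t within {0..1})) has_integral F 1 - F 0) {0..1}"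
  proof (rule fundamental_theorem_of_calculus_interior_strong[OF fin _ _ contF])
    fix t assume t: "t \<in> {0<..<1} - S"
    have vd: "(\<gamma> has_vector_derivative vector_derivative \<gamma> (at t)) (at t)"
      using C1 t by (auto simp: C1_differentiable_on_eq vector_derivative_works)
    have eq: "vector_derivative \<gamma> (at t within {0..1}) = vector_derivative \<gamma> (at t)"
      using t vd vector_derivative_at_within_ivl by force
    have "((G \<circ> \<gamma>) has_vector_derivative vector_derivative \<gamma> (at t) * f (\<gamma> t)) (at t)"
      using field_vector_diff_chain_at[OF vd der] U t by simp
    then have "((\<lambda>t. G (\<gamma> t)) has_vector_derivative f (\<gamma> t) * vector_derivative \<gamma> (at t within {0..1})) (at t)"
      by (simp add: o_def eq mult.commute)
    then show "(F has_vector_derivative f (\<gamma> t) * vector_derivative \<gamma> (at t within {0..1})) (at t)"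
      by (rule has_vector_derivative_transform_within_open[of _ _ _ "{0<..<1}"])
        (use t in \<open>auto simp: F_def\<close>)
  qed simp
  then show ?thesis by (simp add: has_contour_integral_def F_def)
qed

section \<open>Slit domains and the triangular contour\<close>

definition slit_plane :: "complex set" where
  "slit_plane = {z. Im z \<noteq> 0 \<or> 1 < Re z}"

text \<open>This is the image of \<open>slit_plane\<close> under the principal square root.\<close>

definition slit_halfplane :: "complex set" where
  "slit_halfplane = {s. 0 < Re s \<and> (Im s \<noteq> 0 \<or> 1 < Re s)}"

text \<open>For \<open>1 < Re w\<close> and \<open>0 < Im w\<close> this runs anticlockwise about
  \<open>1\<close>, leaves the origin through the lower quadrant and returns through the upper one,
  like the square root of an admissible loop.\<close>

definition triangle_path :: "complex \<Rightarrow> real \<Rightarrow> complex" where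
  "triangle_path w = linepath 0 (cnj w) +++ linepath (cnj w) w +++ linepath w 0"

lemma slit_plane_iff: "z \<in> slit_plane \<longleftrightarrow> z \<notin> complex_of_real ` {..1}"
  by (auto simp: slit_plane_def complex_eq_iff image_iff)

lemma open_slit_plane: "open slit_plane"
  unfolding slit_plane_def
  by (intro open_Collect_disj open_Collect_neq open_Collect_less continuous_intros)

lemma open_slit_halfplane: "open slit_halfplane"
  unfolding slit_halfplane_def
  by (intro open_Collect_conj open_Collect_disj open_Collect_neq open_Collect_less continuous_intros)

lemma square_in_slit_plane: "s \<in> slit_halfplane \<Longrightarrow> s\<^sup>2 \<in> slit_plane"
  by (auto simp: slit_plane_def slit_halfplane_def power2_eq_square mult_less_cancel_left1
      intro: less_1_mult)

text \<open>With the centre \<open>2\<close> on the uncut ray this yields a global primitive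
  directly from Cauchy's theorem for triangles.\<close>

lemma starlike_slit_plane: "starlike slit_plane"
proof -
  have "closed_segment 2 z \<subseteq> slit_plane" if "z \<in> slit_plane" for z
  proof
    fix x assume "x \<in> closed_segment 2 z"
    then obtain u where u: "0 \<le> u" "u \<le> 1" "x = (1 - u) *\<^sub>R 2 + u *\<^sub>R z"
      by (auto simp: closed_segment_def)
    show "x \<in> slit_plane"
    proof (cases "u = 0 \<or> Im z \<noteq> 0")
      case True
      then show ?thesis using u by (auto simp: slit_plane_def)
    next
      case False
      then have "1 < Re z" using that by (auto simp: slit_plane_def)
      then have "u * 1 < u * Re z" using False u by (intro mult_strict_left_mono) auto
      then have "1 < Re x" using u by simp
      then show ?thesis by (simp add: slit_plane_def)
    qed
  qed
  moreover have "2 \<in> slit_plane" by (simp add: slit_plane_def)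
  ultimately show ?thesis unfolding starlike_def by blast
qed

lemma triangle_path_in_slit_halfplane:
  assumes w: "1 < Re w" "0 < Im w" and t: "0 < t" "t < 1"
  shows "triangle_path w t \<in> slit_halfplane"
proof -
  \<comment> \<open>Since \<open>+++\<close> associates to the right, the sides occupy the parameter
    intervals \<open>[0, 1/2]\<close>, \<open>[1/2, 3/4]\<close> and
    \<open>[3/4, 1]\<close>.\<close>
  consider "t \<le> 1/2" | "1/2 < t" "t \<le> 3/4" | "3/4 < t" by linarith
  then show ?thesis
  proof cases
    case 1
    then have "triangle_path w t = (2 * t) *\<^sub>R cnj w"
      by (simp add: triangle_path_def joinpaths_def linepath_def)
    then show ?thesis using w t by (simp add: slit_halfplane_def)
  next
    case 2
    then have "triangle_path w t = linepath (cnj w) w (2 * (2 * t - 1))"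
      by (simp add: triangle_path_def joinpaths_def)
    then have "Re (triangle_path w t) = Re w"
      by (simp add: linepath_def left_diff_distrib)
    then show ?thesis using w t by (simp add: slit_halfplane_def)
  next
    case 3
    then have "triangle_path w t = linepath w 0 (2 * (2 * t - 1) - 1)"
      by (simp add: triangle_path_def joinpaths_def)
    then have "triangle_path w t = (4 - 4 * t) *\<^sub>R w"
      by (simp add: linepath_def complex_eq_iff)
    then show ?thesis using w t by (simp add: slit_halfplane_def)
  qed
qed

lemma triangle_path_near_ends:
  assumes "1 < Re w" "0 < Im w"
  shows "\<forall>\<^sub>F t in at_right 0. 0 < Re (triangle_path w t) \<and> Im (triangle_path w t) < 0"
    and "\<forall>\<^sub>F t in at_left 1. 0 < Re (triangle_path w t) \<and> Im (triangle_path w t) > 0"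
proof -
  show "\<forall>\<^sub>F t in at_right 0. 0 < Re (triangle_path w t) \<and> Im (triangle_path w t) < 0"
    unfolding eventually_at
    by (rule exI[of _ "1/2"])
      (use assms in \<open>auto simp: dist_real_def triangle_path_def joinpaths_def linepath_def\<close>)
  have *: "triangle_path w t = (4 - 4 * t) *\<^sub>R w" if "3/4 < t" for t
    using that by (simp add: triangle_path_def joinpaths_def linepath_def complex_eq_iff)
  show "\<forall>\<^sub>F t in at_left 1. 0 < Re (triangle_path w t) \<and> Im (triangle_path w t) > 0"
    unfolding eventually_at
    by (rule exI[of _ "1/4"])
      (use assms in \<open>auto simp: dist_real_def *\<close>)
qed

lemma valid_triangle_path [simp]: "valid_path (triangle_path w)"
  by (simp add: triangle_path_def valid_path_join)

lemma path_image_triangle_path: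
  "path_image (triangle_path w) =
     closed_segment 0 (cnj w) \<union> closed_segment (cnj w) w \<union> closed_segment w 0"
  by (simp add: triangle_path_def path_image_join Un_assoc)

lemma pathstart_triangle_path [simp]: "pathstart (triangle_path w) = 0"
  and pathfinish_triangle_path [simp]: "pathfinish (triangle_path w) = 0"
  by (simp_all add: triangle_path_def)

lemma path_image_triangle_path_subset:
  assumes "1 < Re w" "0 < Im w"
  shows "path_image (triangle_path w) \<subseteq> insert 0 slit_halfplane"
proof
  fix z assume "z \<in> path_image (triangle_path w)"
  then obtain t where t: "0 \<le> t" "t \<le> 1" "z = triangle_path w t"
    by (auto simp: path_image_def)
  consider "t = 0" | "t = 1" | "0 < t \<and> t < 1" using t by linarith
  then show "z \<in> insert 0 slit_halfplane"
  proof cases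
    case 1 then show ?thesis
      using t pathstart_triangle_path[of w] by (simp add: pathstart_def)
  next
    case 2 then show ?thesis
      using t pathfinish_triangle_path[of w] by (simp add: pathfinish_def)
  next
    case 3 then show ?thesis
      using t triangle_path_in_slit_halfplane[OF assms] by simp
  qed
qed

lemma triangle_path_tendsto_zero:
  "(triangle_path w \<longlongrightarrow> 0) (at_right 0)" "(triangle_path w \<longlongrightarrow> 0) (at_left 1)"
proof -
  have "continuous_on {0..1} (triangle_path w)"
    using valid_path_imp_path[OF valid_triangle_path] by (simp add: path_def)
  moreover have "triangle_path w 0 = 0" "triangle_path w 1 = 0"
    using pathstart_triangle_path[of w] pathfinish_triangle_path[of w]
    by (auto simp: pathstart_def pathfinish_def)
  ultimately show "(triangle_path w \<longlongrightarrow> 0) (at_right 0)" "(triangle_path w \<longlongrightarrow> 0) (at_left 1)"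
    using continuous_on_Icc_at_rightD continuous_on_Icc_at_leftD by fastforce+
qed

text \<open>The derivative \<open>k\<close> of \<open>\<Phi> (s^2)\<close> extends continuously to
  the origin, and continuity at one exceptional point is enough for a primitive \<open>g\<close> on
  the convex set \<open>insert 0 Q\<close>. On the connected set \<open>Q\<close> the two primitives
  differ by a constant, so \<open>\<Phi> (s^2)\<close> inherits the limit of
  \<open>g\<close>.\<close>

lemma primitive_limit_at_zero:
  fixes \<Phi> f :: "complex \<Rightarrow> complex"
  assumes Q: "convex Q" "open Q" "convex (insert 0 Q)" "0 \<notin> Q" "Q \<subseteq> slit_halfplane"
    and der: "\<And>z. z \<in> slit_plane \<Longrightarrow> (\<Phi> has_field_derivative f z) (at z)"
    and hol: "f holomorphic_on slit_plane"
    and lim: "((\<lambda>s. s * f (s\<^sup>2)) \<longlongrightarrow> 0) (at 0 within slit_halfplane)"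
  shows "\<exists>l. ((\<lambda>s. \<Phi> (s\<^sup>2)) \<longlongrightarrow> l) (at 0 within Q)"
proof -
  \<comment> \<open>At \<open>s = 0\<close> the formula itself gives \<open>0\<close>, which is the
    limit provided by \<open>lim\<close>.\<close>
  define k where "k = (\<lambda>s. 2 * s * f (s\<^sup>2))"
  have holk: "k holomorphic_on Q"
    unfolding k_def
    by (intro holomorphic_intros holomorphic_on_compose_gen[OF _ hol, unfolded o_def])
      (use Q square_in_slit_plane in auto)
  have lim_k: "(k \<longlongrightarrow> 0) (at 0 within Q)"
    using tendsto_mult_left[OF tendsto_within_subset[OF lim Q(5)], of 2]
    by (simp add: k_def mult.assoc)
  have contk: "continuous_on (insert 0 Q) k"
    unfolding continuous_on_def
  proof
    fix s assume s: "s \<in> insert 0 Q"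
    show "(k \<longlongrightarrow> k s) (at s within insert 0 Q)"
    proof (cases "s = 0")
      case True
      then show ?thesis
        using lim_k by (simp add: k_def tendsto_within_subset at_within_def insert_Diff_if Q(4))
    next
      case False
      then have "s \<in> Q" using s by simp
      then have "isCont k s"
        using holk Q(2) by (metis continuous_on_eq_continuous_at holomorphic_on_imp_continuous_on)
      then show ?thesis
        by (simp add: isCont_def tendsto_within_subset[where S=UNIV])
    qed
  qed
  have diffk: "k field_differentiable at s" if "s \<in> interior (insert 0 Q) - {0}" for s
    using that holk Q(2) holomorphic_on_imp_differentiable_at interior_subset by blast
  obtain g where g: "\<And>s. s \<in> insert 0 Q \<Longrightarrow> (g has_field_derivative k s) (at s within insert 0 Q)"
    using holomorphic_convex_primitive[OF Q(3) _ contk diffk, of "{0}"] by auto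
  have der0: "((\<lambda>s. \<Phi> (s\<^sup>2) - g s) has_field_derivative 0) (at s)" if s: "s \<in> Q" for s
  proof -
    have "(g has_field_derivative k s) (at s)"
      using g[of s] s Q(2) by (metis DERIV_subset at_within_open insertCI subset_insertI)
    moreover have "((\<lambda>s. \<Phi> (s\<^sup>2)) has_field_derivative f (s\<^sup>2) * (2 * s)) (at s)"
      by (rule DERIV_chain2[OF der]) (use s Q square_in_slit_plane in \<open>auto intro!: derivative_eq_intros\<close>)
    ultimately show ?thesis
      by (auto intro!: derivative_eq_intros simp: k_def)
  qed
  have "continuous_on Q (\<lambda>s. \<Phi> (s\<^sup>2) - g s)"
    using der0 by (blast intro: continuous_at_imp_continuous_on DERIV_isCont)
  then obtain c where c: "\<And>s. s \<in> Q \<Longrightarrow> \<Phi> (s\<^sup>2) - g s = c"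
    using DERIV_zero_connected_constant[of Q "{}" "\<lambda>s. \<Phi> (s\<^sup>2) - g s"] der0
      convex_connected[OF Q(1)] Q(2) by auto
  have "(g \<longlongrightarrow> g 0) (at 0 within insert 0 Q)"
    using DERIV_continuous[OF g[of 0]] by (simp add: continuous_within)
  then have "(g \<longlongrightarrow> g 0) (at 0 within Q)"
    by (rule tendsto_within_subset) auto
  then have "((\<lambda>s. g s + c) \<longlongrightarrow> g 0 + c) (at 0 within Q)"
    by (intro tendsto_intros)
  moreover have "\<forall>\<^sub>F s in at 0 within Q. g s + c = \<Phi> (s\<^sup>2)"
    unfolding eventually_at_filter by (rule always_eventually) (simp add: c[symmetric])
  ultimately have "((\<lambda>s. \<Phi> (s\<^sup>2)) \<longlongrightarrow> g 0 + c) (at 0 within Q)"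
    by (rule Lim_transform_eventually)
  then show ?thesis by blast
qed

text \<open>Although \<open>csqrt\<close> jumps across the negative axis, its modulus is the real
  square root of the modulus, and at the origin this suffices.\<close>

lemma tendsto_csqrt_zero: "(f \<longlongrightarrow> 0) F \<Longrightarrow> ((\<lambda>x. csqrt (f x)) \<longlongrightarrow> 0) F"
  by (rule tendsto_norm_zero_cancel, drule tendsto_norm_zero)
    (use tendsto_real_sqrt[of "\<lambda>x. norm (f x)" 0 F] in \<open>simp add: norm_csqrt\<close>)

text \<open>This converts the half-plane conditions on the two ends of a loop into membership of its
  square root in an open quadrant.\<close>

lemma csqrt_quadrant:
  shows "Im z < 0 \<Longrightarrow> 0 < Re (csqrt z) \<and> Im (csqrt z) < 0 \<and> csqrt z \<noteq> 0"
    and "Im z > 0 \<Longrightarrow> 0 < Re (csqrt z) \<and> Im (csqrt z) > 0 \<and> csqrt z \<noteq> 0"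
proof -
  have *: "Im z = 2 * Re (csqrt z) * Im (csqrt z)"
    by (metis power2_csqrt Im_power2)
  show "Im z < 0 \<Longrightarrow> 0 < Re (csqrt z) \<and> Im (csqrt z) < 0 \<and> csqrt z \<noteq> 0"
    "Im z > 0 \<Longrightarrow> 0 < Re (csqrt z) \<and> Im (csqrt z) > 0 \<and> csqrt z \<noteq> 0"
    using Re_csqrt[of z] unfolding *
    by (auto simp del: Re_csqrt csqrt.sel simp: mult_less_0_iff zero_less_mult_iff)
qed

text \<open>The sign of \<open>\<sigma>\<close> selects the upper or the lower quadrant. Adding the
  vertex preserves convexity because \<open>Q\<close> is a convex cone.\<close>

lemma quadrant:
  fixes \<sigma> :: real
  assumes "\<sigma> \<noteq> 0"
  defines "Q \<equiv> {s. 0 < Re s \<and> 0 < \<sigma> * Im s}"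
  shows "convex Q" "open Q" "convex (insert 0 Q)" "0 \<notin> Q" "Q \<subseteq> slit_halfplane"
proof -
  show cvx: "convex Q"
    unfolding convex_alt Q_def
  proof (clarsimp, intro conjI)
    fix x y u assume *: "0 < Re x" "0 < \<sigma> * Im x" "0 < Re y" "0 < \<sigma> * Im y" "0 \<le> u" "u \<le> (1::real)"
    have pos: "0 < (1 - u) * a + u * b" if "0 < a" "0 < b" for a b
      using that * convex_bound_lt[of "-a" 0 "-b" "1 - u" u] by simp
    show "0 < (1 - u) * Re x + u * Re y" using pos * by blast
    show "0 < \<sigma> * ((1 - u) * Im x + u * Im y)"
      using pos[of "\<sigma> * Im x" "\<sigma> * Im y"] * by (simp add: algebra_simps)
  qed
  show "open Q" unfolding Q_def
    by (intro open_Collect_conj open_Collect_less continuous_intros)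
  show "0 \<notin> Q" "Q \<subseteq> slit_halfplane" by (auto simp: Q_def slit_halfplane_def)
  have scale: "c *\<^sub>R x \<in> Q" if "x \<in> Q" "0 < c" for c x
    using that mult_pos_pos[of c "\<sigma> * Im x"] by (simp add: Q_def mult.left_commute)
  show "convex (insert 0 Q)"
    unfolding convex_alt
  proof (intro ballI allI impI)
    fix x y u assume *: "x \<in> insert 0 Q" "y \<in> insert 0 Q" "0 \<le> u \<and> u \<le> (1::real)"
    then consider "u = 0" | "u = 1" | "0 < u" "u < 1" by linarith
    then show "(1 - u) *\<^sub>R x + u *\<^sub>R y \<in> insert 0 Q"
    proof cases
      case 3
      then show ?thesis
        using * scale[of x "1 - u"] scale[of y u] cvx[unfolded convex_alt] by auto
    qed (use * in auto)
  qed
qed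

text \<open>Both integrals equal the difference of the two one-sided boundary values at the origin of a
  primitive on the slit plane. In the variable \<open>s\<close> with \<open>\<tau> = s\<^sup>2\<close> the primitive is differentiable
  up to the origin on each quadrant; this gives the boundary values without any assumption on how
  \<open>\<gamma>\<close> approaches the origin, where the integrand need not be absolutely integrable.\<close>
lemma has_contour_integral_loop:
  fixes f :: "complex \<Rightarrow> complex"
  assumes hol: "f holomorphic_on slit_plane"
    and lim: "((\<lambda>s. s * f (s\<^sup>2)) \<longlongrightarrow> 0) (at 0 within slit_halfplane)"
    and w: "1 < Re w" "0 < Im w" and \<gamma>: "loop_around_1 \<gamma>"
  obtains I where "(f has_contour_integral I) \<gamma>"
    and "((\<lambda>s. 2 * s * f (s\<^sup>2)) has_contour_integral I) (triangle_path w)"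
proof -
  have \<gamma>': "valid_path \<gamma>" "\<gamma> 0 = 0" "\<gamma> 1 = 0"
    "\<And>t. 0 < t \<Longrightarrow> t < 1 \<Longrightarrow> \<gamma> t \<in> slit_plane"
    "\<forall>\<^sub>F t in at_right 0. Im (\<gamma> t) < 0" "\<forall>\<^sub>F t in at_left 1. Im (\<gamma> t) > 0"
    using \<gamma> by (auto simp: loop_around_1_def slit_plane_iff pathstart_def pathfinish_def)
  obtain \<Phi> where \<Phi>: "\<And>z. z \<in> slit_plane \<Longrightarrow> (\<Phi> has_field_derivative f z) (at z)"
    using holomorphic_starlike_primitive[OF holomorphic_on_imp_continuous_on[OF hol]
        starlike_slit_plane open_slit_plane, of "{}"]
      holomorphic_on_imp_differentiable_at[OF hol open_slit_plane] by auto
  define Qm where "Qm = {s. 0 < Re s \<and> 0 < (-1) * Im s}"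
  define Qp where "Qp = {s. 0 < Re s \<and> 0 < 1 * Im s}"
  note Qm = quadrant[of "-1", folded Qm_def] and Qp = quadrant[of 1, folded Qp_def]
  obtain lm where lm: "((\<lambda>s. \<Phi> (s\<^sup>2)) \<longlongrightarrow> lm) (at 0 within Qm)"
    using primitive_limit_at_zero[OF Qm \<Phi> hol lim] by auto
  obtain lp where lp: "((\<lambda>s. \<Phi> (s\<^sup>2)) \<longlongrightarrow> lp) (at 0 within Qp)"
    using primitive_limit_at_zero[OF Qp \<Phi> hol lim] by auto
  have c\<gamma>: "continuous_on {0..1} \<gamma>"
    using \<gamma>'(1) by (simp add: valid_path_imp_path path_def[symmetric])
  have lim0: "(\<gamma> \<longlongrightarrow> 0) (at_right 0)" and lim1: "(\<gamma> \<longlongrightarrow> 0) (at_left 1)"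
    using continuous_on_Icc_at_rightD[OF c\<gamma>] continuous_on_Icc_at_leftD[OF c\<gamma>] \<gamma>'(2,3) by auto
  have "((\<lambda>t. csqrt (\<gamma> t)) \<longlongrightarrow> 0) (at_right 0)" "((\<lambda>t. csqrt (\<gamma> t)) \<longlongrightarrow> 0) (at_left 1)"
    using tendsto_csqrt_zero[OF lim0] tendsto_csqrt_zero[OF lim1] by auto
  \<comment> \<open>Since \<open>csqrt\<close> is a right inverse of squaring, the limits of
    \<open>\<Phi> (s^2)\<close> in the two quadrants become the limits of \<open>\<Phi>\<close>
    along \<open>\<gamma>\<close>.\<close>
  then have "filterlim (\<lambda>t. csqrt (\<gamma> t)) (at 0 within Qm) (at_right 0)"
     "filterlim (\<lambda>t. csqrt (\<gamma> t)) (at 0 within Qp) (at_left 1)"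
    unfolding filterlim_at
    using eventually_mono[OF \<gamma>'(5)] eventually_mono[OF \<gamma>'(6)] csqrt_quadrant
    by (auto simp: Qm_def Qp_def elim!: eventually_mono)
  from filterlim_compose[OF lm this(1)] filterlim_compose[OF lp this(2)]
  have "(f has_contour_integral (lp - lm)) \<gamma>"
    by (intro has_contour_integral_primitive_limits[OF \<gamma>'(1,4) \<Phi>]) auto
  moreover have "((\<lambda>s. 2 * s * f (s\<^sup>2)) has_contour_integral (lp - lm)) (triangle_path w)"
  proof (rule has_contour_integral_primitive_limits)
    have "filterlim (triangle_path w) (at 0 within Qm) (at_right 0)"
      "filterlim (triangle_path w) (at 0 within Qp) (at_left 1)"
      unfolding filterlim_at using triangle_path_near_ends[OF w] triangle_path_tendsto_zero[of w]
      by (auto simp: Qm_def Qp_def elim!: eventually_mono)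
    from filterlim_compose[OF lm this(1)] filterlim_compose[OF lp this(2)]
    show "((\<lambda>t. \<Phi> ((triangle_path w t)\<^sup>2)) \<longlongrightarrow> lm) (at_right 0)"
      "((\<lambda>t. \<Phi> ((triangle_path w t)\<^sup>2)) \<longlongrightarrow> lp) (at_left 1)" by auto
    show "((\<lambda>s. \<Phi> (s\<^sup>2)) has_field_derivative 2 * s * f (s\<^sup>2)) (at s)" if "s \<in> slit_halfplane" for s
    proof -
      have "((\<lambda>s. s\<^sup>2) has_field_derivative 2 * s) (at s)"
        by (auto intro!: derivative_eq_intros)
      then show ?thesis
        using DERIV_chain2[where g = "\<lambda>s. s\<^sup>2" and x = s, OF \<Phi>[OF square_in_slit_plane[OF that]]]
        by (simp add: mult.commute)
    qed
  qed (use triangle_path_in_slit_halfplane[OF w] in auto)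
  ultimately show ?thesis using that by blast
qed

section \<open>The complementary error function\<close>

lemma has_integral_complex_of_real:
  "(f has_integral I) S \<Longrightarrow> ((\<lambda>x. complex_of_real (f x)) has_integral of_real I) S"
  using has_integral_linear[OF _ bounded_linear_of_real, of f I S] by (simp add: o_def)

lemma integral_complex_of_real:
  "integral S (\<lambda>x. complex_of_real (f x)) = of_real (integral S f)"
proof (cases "f integrable_on S")
  case True
  then show ?thesis
    by (intro integral_unique has_integral_complex_of_real integrable_integral)
next
  \<comment> \<open>Both integrals have the default value \<open>0\<close> here, so the transfer
    from real to complex needs no convergence.\<close>
  case False
  moreover have "f integrable_on S" if "(\<lambda>x. complex_of_real (f x)) integrable_on S"
    using integrable_linear[OF that bounded_linear_Re] by (simp add: o_def)
  ultimately show ?thesis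
    by (metis not_integrable_integral of_real_0)
qed

text \<open>This is the duplication formula at \<open>j + 1\<close>, in the form that absorbs the
  factorials left by the odd Gaussian moments.\<close>

lemma Gamma_real_plus_three_halves:
  "Gamma (real j + 3/2) = sqrt pi * fact (2 * j + 1) / (2 ^ (2 * j + 1) * fact j)"
proof (induction j)
  case 0
  have "Gamma (1/2 + 1 :: real) = 1/2 * Gamma (1/2)"
    by (rule Gamma_plus1) (auto elim!: nonpos_Ints_cases)
  then show ?case by (simp add: Gamma_one_half_real)
next
  case (Suc j)
  have "Gamma (real j + 3/2 + 1) = (real j + 3/2) * Gamma (real j + 3/2)"
    by (rule Gamma_plus1) (use nonpos_Ints_nonpos[of "real j + 3/2"] in auto)
  then have *: "Gamma (real (Suc j) + 3/2) = (real j + 3/2) * Gamma (real j + 3/2)"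
    by (simp add: algebra_simps)
  show ?case
    unfolding * Suc.IH by (simp add: divide_simps)
qed

lemma has_integral_gaussian_moment:
  "((\<lambda>x::real. exp (- x\<^sup>2) * x ^ (2 * j)) has_integral
     sqrt pi / 2 * (fact (2 * j) / (2 ^ (2 * j) * fact j))) {0..}"
  "((\<lambda>x::real. exp (- x\<^sup>2) * x ^ (2 * j + 1)) has_integral fact j / 2) {0..}"
proof -
  have *: "(f has_integral I) {0..}"
    if "has_bochner_integral lborel (\<lambda>x. indicator {0..} x *\<^sub>R f x) I" for f :: "real \<Rightarrow> real" and I
  proof -
    have "set_integrable lborel {0..} f" "(LINT x:{0..}|lborel. f x) = I"
      using that by (auto simp: set_integrable_def set_lebesgue_integral_def has_bochner_integral_iff)
    then show ?thesis
      using set_borel_integral_eq_integral[of "{0..}" f] by (metis integrable_integral)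
  qed
  show "((\<lambda>x::real. exp (- x\<^sup>2) * x ^ (2 * j)) has_integral
     sqrt pi / 2 * (fact (2 * j) / (2 ^ (2 * j) * fact j))) {0..}"
    by (rule *[OF gaussian_moment_even_pos])
  show "((\<lambda>x::real. exp (- x\<^sup>2) * x ^ (2 * j + 1)) has_integral fact j / 2) {0..}"
    by (rule *[OF gaussian_moment_odd_pos])
qed

text \<open>Up to a constant factor this is the dominating function for the partial sums in
  \<open>erfc_sums\<close>.\<close>

lemma integrable_exp_half_square: "(\<lambda>x::real. exp (- x\<^sup>2 / 2)) integrable_on {0..}"
proof -
  have "integrable lborel (\<lambda>x. sqrt (2 * pi) * std_normal_density x)"
    by (intro integrable_mult_right integrable_normal_density) simp
  then have "integrable lborel (\<lambda>x::real. exp (- x\<^sup>2 / 2))"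
    by (simp add: std_normal_density_def)
  then have "set_integrable lborel {0..} (\<lambda>x::real. exp (- x\<^sup>2 / 2))"
    unfolding set_integrable_def by (intro integrable_mult_indicator) auto
  then show ?thesis
    by (rule set_borel_integral_eq_integral)
qed

text \<open>Because \<open>exp (z^2) * exp (- (s - z)^2) = exp (2 * z * s) * exp (- s^2)\<close>,
  the expansion of \<open>exp (2 * z * s)\<close> leaves the half-line moments of the Gaussian. The
  even ones add up to \<open>exp (z^2)\<close>, the odd ones to the series stated.\<close>

lemma erfc_sums:
  fixes z :: complex
  shows "(\<lambda>j. z ^ (2 * j + 1) / of_real (Gamma (real j + 3/2))) sums (exp (z\<^sup>2) * (erfc (- z) - 1))"
proof -
  define F where "F = (\<lambda>N (s::real). \<Sum>k<N. (2 * z) ^ k / fact k * of_real (exp (- s\<^sup>2) * s ^ k))"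
  define m where "m = (\<lambda>k. integral {0..} (\<lambda>s::real. exp (- s\<^sup>2) * s ^ k))"
  have m_even: "m (2 * j) = sqrt pi / 2 * (fact (2 * j) / (2 ^ (2 * j) * fact j))"
    and m_odd: "m (Suc (2 * j)) = fact j / 2" for j
    using has_integral_gaussian_moment[of j] by (auto simp: m_def integral_unique)
  have mom: "((\<lambda>s. exp (- s\<^sup>2) * s ^ k) has_integral m k) {0..}" for k
    unfolding m_def
    by (cases "even k")
      (auto elim!: evenE oddE intro!: has_integral_integrable[OF has_integral_gaussian_moment(1)]
        has_integral_integrable[OF has_integral_gaussian_moment(2)] simp flip: has_integral_integral)
  have F_int: "(F N has_integral (\<Sum>k<N. (2 * z) ^ k / fact k * of_real (m k))) {0..}" for N
    unfolding F_def
    by (intro has_integral_sum has_integral_mult_right finite_lessThan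
        has_integral_complex_of_real[OF mom])
  have "(\<lambda>N. integral {0..} (F N)) \<longlonglongrightarrow> integral {0..} (\<lambda>s::real. exp (z\<^sup>2) * exp (- ((- z + of_real s)\<^sup>2)))"
  proof (rule dominated_convergence)
    show "F N integrable_on {0..}" for N
      using F_int by (rule has_integral_integrable)
    show "(\<lambda>s. exp (2 * (cmod z)\<^sup>2) * exp (- s\<^sup>2 / 2)) integrable_on {0..}"
      by (rule has_integral_integrable[OF has_integral_mult_right[OF
            integrable_integral[OF integrable_exp_half_square]]])
  next
    fix N and s :: real assume "s \<in> {0..}"
    then have s: "0 \<le> s" by simp
    have "cmod (F N s) \<le> (\<Sum>k<N. (2 * cmod z * s) ^ k / fact k * exp (- s\<^sup>2))"
      unfolding F_def
      by (rule sum_norm_le) (simp add: norm_mult norm_divide norm_power s power_mult_distrib mult_ac)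
    also have "\<dots> \<le> exp (2 * cmod z * s) * exp (- s\<^sup>2)"
    proof -
      have "(\<Sum>k<N. (2 * cmod z * s) ^ k / fact k) \<le> exp (2 * cmod z * s)"
        using sum_le_suminf[OF summable_exp[of "2 * cmod z * s"], of "{..<N}"] s
        by (simp add: exp_def divide_inverse mult.commute)
      then show ?thesis
        unfolding sum_distrib_right[symmetric] by (rule mult_right_mono) simp
    qed
    also have "\<dots> = exp (2 * cmod z * s - s\<^sup>2)"
      by (simp add: exp_diff exp_minus divide_inverse)
    \<comment> \<open>Completing the square gives up half of the Gaussian decay to absorb
      \<open>exp (2 * cmod z * s)\<close>, uniformly in \<open>N\<close>.\<close>
    also have "\<dots> \<le> exp (2 * (cmod z)\<^sup>2 - s\<^sup>2 / 2)"
      using zero_le_power2[of "s - 2 * cmod z"] by (simp add: power2_eq_square algebra_simps)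
    finally show "cmod (F N s) \<le> exp (2 * (cmod z)\<^sup>2) * exp (- s\<^sup>2 / 2)"
      by (simp add: mult_exp_exp)
  next
    fix s :: real
    have "(\<lambda>k. (2 * z * of_real s) ^ k /\<^sub>R fact k) sums exp (2 * z * of_real s)"
      by (rule exp_converges)
    then have "(\<lambda>k. (2 * z * of_real s) ^ k /\<^sub>R fact k * of_real (exp (- s\<^sup>2))) sums (exp (2 * z * of_real s) * of_real (exp (- s\<^sup>2)))"
      by (rule sums_mult2)
    moreover have "exp (2 * z * of_real s) * of_real (exp (- s\<^sup>2)) = exp (z\<^sup>2) * exp (- ((- z + of_real s)\<^sup>2))"
      by (simp add: exp_of_real[symmetric] mult_exp_exp power2_eq_square algebra_simps)
    ultimately show "(\<lambda>N. F N s) \<longlonglongrightarrow> exp (z\<^sup>2) * exp (- ((- z + of_real s)\<^sup>2))"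
      by (simp add: sums_def F_def scaleR_conv_of_real power_mult_distrib divide_inverse mult_ac)
  qed
  then have "(\<lambda>N. 2 / sqrt pi * integral {0..} (F N)) \<longlonglongrightarrow>
      2 / sqrt pi * (exp (z\<^sup>2) * integral {0..} (\<lambda>s::real. exp (- ((- z + of_real s)\<^sup>2))))"
    by (intro tendsto_mult_left) simp
  then have "(\<lambda>k. 2 / sqrt pi * ((2 * z) ^ k / fact k * of_real (m k))) sums (exp (z\<^sup>2) * erfc (- z))"
    by (simp add: integral_unique[OF F_int] sums_def sum_distrib_left erfc_def mult_ac)
  \<comment> \<open>Grouping in pairs puts one even and one odd moment into each term, so that the
    even part can be subtracted.\<close>
  from sums_group[OF this, of 2]
  have "(\<lambda>j. 2 / sqrt pi * ((2 * z) ^ (2 * j) / fact (2 * j) * of_real (m (2 * j))) +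
       2 / sqrt pi * ((2 * z) ^ (Suc (2 * j)) / fact (Suc (2 * j)) * of_real (m (Suc (2 * j)))))
     sums (exp (z\<^sup>2) * erfc (- z))"
    by (simp add: numeral_2_eq_2 mult.commute)
  moreover have "2 / sqrt pi * ((2 * z) ^ (2 * j) / fact (2 * j) * of_real (m (2 * j))) = (z\<^sup>2) ^ j / fact j" for j
    unfolding m_even by (simp add: power_mult_distrib power_mult[symmetric] divide_simps)
  moreover have "2 / sqrt pi * ((2 * z) ^ (Suc (2 * j)) / fact (Suc (2 * j)) * of_real (m (Suc (2 * j)))) =
      z ^ (2 * j + 1) / of_real (Gamma (real j + 3/2))" for j
    unfolding m_odd Gamma_real_plus_three_halves
    by (simp add: power_mult_distrib divide_simps del: fact_Suc)
  ultimately have "(\<lambda>j. (z\<^sup>2) ^ j / fact j + z ^ (2 * j + 1) / of_real (Gamma (real j + 3/2)))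
      sums (exp (z\<^sup>2) * erfc (- z))"
    by (simp only:)
  moreover have "(\<lambda>j. (z\<^sup>2) ^ j / fact j) sums exp (z\<^sup>2)"
    using exp_converges[of "z\<^sup>2"] by (simp add: scaleR_conv_of_real divide_inverse mult.commute)
  ultimately show ?thesis
    using sums_diff by (fastforce simp: algebra_simps)
qed

text \<open>Convergence is read off from \<open>erfc_sums\<close> at \<open>csqrt u\<close>; the
  division by \<open>csqrt u\<close> makes \<open>u = 0\<close> a separate case.\<close>

lemma summable_odd_erfc_series:
  "summable (\<lambda>j. u ^ j / complex_of_real (Gamma (real j + 3/2)))"
proof (cases "u = 0")
  case True
  then show ?thesis by (auto intro!: summable_finite[of "{0}"])
next
  case False
  have "summable (\<lambda>j. csqrt u ^ (2 * j + 1) / of_real (Gamma (real j + 3/2)) / csqrt u)"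
    using erfc_sums[of "csqrt u"] by (intro summable_divide) (rule sums_summable)
  then show ?thesis using False by (simp add: power_mult)
qed

lemma erfc_minus_eq:
  fixes z :: complex
  shows "erfc (- z) = 1 + exp (- (z\<^sup>2)) * z * (\<Sum>j. (z\<^sup>2) ^ j / of_real (Gamma (real j + 3/2)))"
proof -
  have "(\<lambda>j. z * ((z\<^sup>2) ^ j / of_real (Gamma (real j + 3/2)))) sums (exp (z\<^sup>2) * (erfc (- z) - 1))"
    using erfc_sums[of z] by (simp add: power_mult)
  then have "exp (z\<^sup>2) * (erfc (- z) - 1) = z * (\<Sum>j. (z\<^sup>2) ^ j / of_real (Gamma (real j + 3/2)))"
    using suminf_mult[OF summable_odd_erfc_series, of z "z\<^sup>2"] by (simp add: sums_iff)
  then have "exp (- (z\<^sup>2)) * (exp (z\<^sup>2) * (erfc (- z) - 1)) =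
      exp (- (z\<^sup>2)) * z * (\<Sum>j. (z\<^sup>2) ^ j / of_real (Gamma (real j + 3/2)))"
    by simp
  moreover have "exp (- (z\<^sup>2)) * (exp (z\<^sup>2) * (erfc (- z) - 1)) = erfc (- z) - 1"
    by (simp add: exp_minus)
  ultimately show ?thesis by (simp add: algebra_simps)
qed

text \<open>By \<open>erfc_minus_eq\<close>, \<open>erfc (- z) - 1\<close> is an odd function of
  \<open>z\<close>.\<close>

lemma erfc_reflect: "erfc z + erfc (- z) = (2 :: complex)"
proof -
  have "erfc (- (- z)) + erfc (- z) = 2"
    unfolding erfc_minus_eq by simp
  then show ?thesis by simp
qed

text \<open>The everywhere convergent power series \<open>V\<close> replaces differentiation under
  the integral sign.\<close>

lemma holomorphic_erfc: "erfc holomorphic_on (UNIV :: complex set)"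
proof -
  define V where "V = (\<lambda>u::complex. \<Sum>j. inverse (of_real (Gamma (real j + 3/2))) * u ^ j)"
  have "summable (\<lambda>j. inverse (complex_of_real (Gamma (real j + 3/2))) * u ^ j)" for u
    using summable_odd_erfc_series[of u] by (simp only: divide_inverse mult.commute)
  from termdiffs_strong_converges_everywhere[OF this]
  have "V field_differentiable at u" for u
    unfolding field_differentiable_def V_def by blast
  then have V: "V holomorphic_on UNIV"
    by (simp add: holomorphic_on_def field_differentiable_at_within)
  have "(\<lambda>z. 1 + exp (- ((- z)\<^sup>2)) * (- z) * V ((- z)\<^sup>2)) holomorphic_on UNIV"
    by (intro holomorphic_intros holomorphic_on_compose_gen[OF _ V, unfolded o_def]) auto
  moreover have "erfc z = 1 + exp (- ((- z)\<^sup>2)) * (- z) * V ((- z)\<^sup>2)" for z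
    using erfc_minus_eq[of "- z"] unfolding V_def minus_minus divide_inverse
    by (simp only: mult.commute)
  ultimately show ?thesis by (simp cong: holomorphic_cong)
qed

lemma of_real_erfc: "complex_of_real (erfc x) = erfc (complex_of_real x)"
proof -
  have "integral {0..} (\<lambda>s::real. exp (- ((of_real x + of_real s)\<^sup>2))) =
     integral {0..} (\<lambda>s::real. complex_of_real (exp (- ((x + s)\<^sup>2))))"
    by (simp add: exp_of_real[symmetric])
  then show ?thesis
    by (simp add: erfc_def integral_complex_of_real)
qed

section \<open>The beta loop integral\<close>

text \<open>The form \<open>\<tau> powr (p + q - 1) * (\<tau> - 1) powr (- q) d\<tau>\<close> in the variable \<open>s\<close> with \<open>\<tau> = s\<^sup>2\<close>.\<close>
definition beta_kernel :: "real \<Rightarrow> real \<Rightarrow> complex \<Rightarrow> complex" where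
  "beta_kernel p q s = 2 * s powr of_real (2 * (p + q) - 1) * (s\<^sup>2 - 1) powr of_real (- q)"

lemma slit_halfplane_nonpos_Reals:
  assumes "s \<in> slit_halfplane"
  shows "s \<notin> \<real>\<^sub>\<le>\<^sub>0" "s\<^sup>2 - 1 \<notin> \<real>\<^sub>\<le>\<^sub>0"
  using assms square_in_slit_plane[OF assms]
  by (auto simp: slit_halfplane_def slit_plane_def complex_nonpos_Reals_iff)

lemma has_field_derivative_powr_product:
  fixes a b :: real
  assumes "s \<in> slit_halfplane"
  shows "((\<lambda>s. s powr of_real a * (s\<^sup>2 - 1) powr of_real b) has_field_derivative
    (of_real a * s powr of_real (a - 1) * (s\<^sup>2 - 1) powr of_real b
     + 2 * of_real b * s powr of_real (a + 1) * (s\<^sup>2 - 1) powr of_real (b - 1))) (at s)"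
proof -
  note nz = slit_halfplane_nonpos_Reals[OF assms]
  have "s \<noteq> 0" using assms by (auto simp: slit_halfplane_def)
  have sq: "((\<lambda>s. s\<^sup>2 - 1) has_field_derivative 2 * s) (at s)"
    by (auto intro!: derivative_eq_intros)
  have "((\<lambda>s. (s\<^sup>2 - 1) powr of_real b) has_field_derivative
      of_real b * (s\<^sup>2 - 1) powr (of_real b - 1) * (2 * s)) (at s)"
    by (rule DERIV_chain2[where g = "\<lambda>s. s\<^sup>2 - 1", OF has_field_derivative_powr[OF nz(2)] sq])
  from DERIV_mult[OF has_field_derivative_powr[OF nz(1), of "of_real a"] this]
  show ?thesis
    by (rule DERIV_cong) (use \<open>s \<noteq> 0\<close> in \<open>simp add: powr_add algebra_simps\<close>)
qed

lemma holomorphic_powr_product: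
  "(\<lambda>s. s powr of_real a * (s\<^sup>2 - 1) powr of_real b) holomorphic_on slit_halfplane"
  unfolding holomorphic_on_open[OF open_slit_halfplane]
  using has_field_derivative_powr_product by blast

text \<open>At the origin \<open>s^2 - 1\<close> equals \<open>-1\<close>, on the branch cut of the
  second factor, so that factor may have no limit. Its modulus is continuous there, and the limit is
  taken in norm.\<close>

lemma tendsto_powr_product_zero:
  fixes a b :: real
  assumes "0 < a"
  shows "((\<lambda>s::complex. s powr of_real a * (s\<^sup>2 - 1) powr of_real b) \<longlongrightarrow> 0) (at 0)"
proof (rule tendsto_norm_zero_cancel)
  have "((\<lambda>s::complex. cmod s powr a * cmod (s\<^sup>2 - 1) powr b) \<longlongrightarrow> 0 powr a * cmod (0\<^sup>2 - 1) powr b) (at 0)"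
    using assms tendsto_norm[OF tendsto_ident_at, of "0::complex" UNIV]
    by (intro tendsto_intros tendsto_powr') auto
  then show "((\<lambda>s::complex. norm (s powr of_real a * (s\<^sup>2 - 1) powr of_real b)) \<longlongrightarrow> 0) (at 0)"
    by (simp add: norm_mult norm_powr_real_powr')
qed

lemma continuous_on_powr_product:
  fixes a b :: real
  assumes "0 < a"
  shows "continuous_on (insert 0 slit_halfplane) (\<lambda>s. s powr of_real a * (s\<^sup>2 - 1) powr of_real b)"
proof (rule continuous_at_imp_continuous_on, rule ballI)
  fix s assume "s \<in> insert 0 slit_halfplane"
  then consider "s = 0" | "s \<in> slit_halfplane" by auto
  then show "isCont (\<lambda>s. s powr of_real a * (s\<^sup>2 - 1) powr of_real b) s"
  proof cases
    \<comment> \<open>The convention \<open>0 powr c = 0\<close> makes the value at the origin agree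
      with the limit.\<close>
    case 1
    then show ?thesis using tendsto_powr_product_zero[OF assms, of b] by (simp add: isCont_def)
  next
    case 2
    then show ?thesis by (rule DERIV_isCont[OF has_field_derivative_powr_product])
  qed
qed

lemma continuous_on_beta_kernel:
  assumes "1/2 < p + q"
  shows "continuous_on (insert 0 slit_halfplane) (beta_kernel p q)"
  unfolding beta_kernel_def mult.assoc
  using assms by (intro continuous_on_mult continuous_on_const continuous_on_powr_product) simp

section \<open>Integration along the triangle and recurrences for the loop integral\<close>

lemma contour_integrable_triangle_path:
  assumes "continuous_on (path_image (triangle_path w)) f"
  shows "f contour_integrable_on triangle_path w"
  unfolding triangle_path_def
  by (intro contour_integrable_joinI contour_integrable_continuous_linepath valid_path_join
      valid_path_linepath; (rule continuous_on_subset[OF assms])?)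
    (auto simp: path_image_triangle_path)

lemma contour_integral_triangle_path:
  assumes "continuous_on (path_image (triangle_path w)) f"
  shows "contour_integral (triangle_path w) f = contour_integral (linepath 0 (cnj w)) f +
    contour_integral (linepath (cnj w) w) f + contour_integral (linepath w 0) f"
  using has_chain_integral_chain_integral3[OF has_contour_integral_integral[OF
        contour_integrable_triangle_path[OF assms], unfolded triangle_path_def]]
  by (simp add: triangle_path_def)

lemma contour_integrable_beta_kernel:
  assumes "1 < Re w" "0 < Im w" "1/2 < p + q"
  shows "beta_kernel p q contour_integrable_on triangle_path w"
  using continuous_on_subset[OF continuous_on_beta_kernel[OF assms(3)] path_image_triangle_path_subset[OF assms(1,2)]]
  by (rule contour_integrable_triangle_path)

text \<open>The primitive may lie on different branches at the two ends of the loop; the integral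
  vanishes because both boundary values are \<open>0\<close>.\<close>

lemma has_contour_integral_triangle_primitive:
  assumes w: "1 < Re w" "0 < Im w"
    and der: "\<And>s. s \<in> slit_halfplane \<Longrightarrow> (G has_field_derivative f s) (at s)"
    and lim: "(G \<longlongrightarrow> 0) (at 0)"
  shows "(f has_contour_integral 0) (triangle_path w)"
proof -
  have "filterlim (triangle_path w) (at 0) (at_right 0)"
    "filterlim (triangle_path w) (at 0) (at_left 1)"
    unfolding filterlim_at using triangle_path_near_ends[OF w] triangle_path_tendsto_zero[of w]
    by (auto elim!: eventually_mono)
  then have "((\<lambda>t. G (triangle_path w t)) \<longlongrightarrow> 0) (at_right 0)" "((\<lambda>t. G (triangle_path w t)) \<longlongrightarrow> 0) (at_left 1)"
    using filterlim_compose[OF lim] by auto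
  then have "(f has_contour_integral 0 - 0) (triangle_path w)"
    by (intro has_contour_integral_primitive_limits[where U = slit_halfplane and G = G])
      (use der triangle_path_in_slit_halfplane[OF w] in auto)
  then show ?thesis by simp
qed

text \<open>In the variable \<open>\<tau>\<close> the primitive is
  \<open>\<tau> powr (p + q) * (\<tau> - 1) powr (- q)\<close>. It tends to \<open>0\<close> at the
  origin for either sign of \<open>q\<close>, which allows the use at negative \<open>q\<close>
  below.\<close>

lemma contour_integral_beta_kernel_Suc_right:
  assumes w: "1 < Re w" "0 < Im w" and pq: "1/2 < p + q"
  shows "of_real (p + q) * contour_integral (triangle_path w) (beta_kernel p q) =
    of_real q * contour_integral (triangle_path w) (beta_kernel p (q + 1))"
proof -
  have "((\<lambda>s. of_real (p + q) * beta_kernel p q s - of_real q * beta_kernel p (q + 1) s)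
      has_contour_integral 0) (triangle_path w)"
  proof (rule has_contour_integral_triangle_primitive[OF w])
    show "((\<lambda>s::complex. s powr of_real (2 * (p + q)) * (s\<^sup>2 - 1) powr of_real (- q)) \<longlongrightarrow> 0) (at 0)"
      using pq by (intro tendsto_powr_product_zero) simp
    show "((\<lambda>s. s powr of_real (2 * (p + q)) * (s\<^sup>2 - 1) powr of_real (- q)) has_field_derivative
      of_real (p + q) * beta_kernel p q s - of_real q * beta_kernel p (q + 1) s) (at s)"
      if "s \<in> slit_halfplane" for s
    proof (rule DERIV_cong[OF has_field_derivative_powr_product[OF that]])
      have e: "- (q + 1) = - q - 1" "2 * (p + (q + 1)) - 1 = 2 * (p + q) + 1" by simp_all
      show "of_real (2 * (p + q)) * s powr of_real (2 * (p + q) - 1) * (s\<^sup>2 - 1) powr of_real (- q) +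
          2 * of_real (- q) * s powr of_real (2 * (p + q) + 1) * (s\<^sup>2 - 1) powr of_real (- q - 1) =
          of_real (p + q) * beta_kernel p q s - of_real q * beta_kernel p (q + 1) s"
        unfolding beta_kernel_def e by simp
    qed
  qed
  moreover have "((\<lambda>s. of_real (p + q) * beta_kernel p q s - of_real q * beta_kernel p (q + 1) s)
      has_contour_integral
      of_real (p + q) * contour_integral (triangle_path w) (beta_kernel p q) -
      of_real q * contour_integral (triangle_path w) (beta_kernel p (q + 1))) (triangle_path w)"
    using pq
    by (intro has_contour_integral_diff has_contour_integral_lmul has_contour_integral_integral
        contour_integrable_beta_kernel w) auto
  ultimately have "of_real (p + q) * contour_integral (triangle_path w) (beta_kernel p q) -
      of_real q * contour_integral (triangle_path w) (beta_kernel p (q + 1)) = 0"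
    using has_contour_integral_unique by blast
  then show ?thesis by simp
qed

lemma beta_kernel_Suc_left:
  assumes "s \<in> insert 0 slit_halfplane"
  shows "beta_kernel (p + 1) q s - beta_kernel p q s = beta_kernel (p + 1) (q - 1) s"
    and "beta_kernel (p + 1) q s = s\<^sup>2 * beta_kernel p q s"
proof -
  have "beta_kernel (p + 1) q s = s\<^sup>2 * beta_kernel p q s
     \<and> beta_kernel (p + 1) (q - 1) s = (s\<^sup>2 - 1) * beta_kernel p q s"
  proof (cases "s = 0")
    case False
    then have s: "s \<in> slit_halfplane" using assms by simp
    have "s\<^sup>2 - 1 \<noteq> 0"
      using slit_halfplane_nonpos_Reals[OF s] by auto
    have 1: "s powr of_real (2 * (p + 1 + q) - 1) = s powr of_real (2 * (p + q) - 1) * s\<^sup>2"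
      using False powr_add[of s "of_real (2 * (p + q) - 1)" 2] powr_nat[of s 2]
      by (simp add: algebra_simps)
    have 2: "(s\<^sup>2 - 1) powr of_real (- (q - 1)) = (s\<^sup>2 - 1) powr of_real (- q) * (s\<^sup>2 - 1)"
      using \<open>s\<^sup>2 - 1 \<noteq> 0\<close> powr_add[of "s\<^sup>2 - 1" "of_real (- q)" 1]
      by (simp add: algebra_simps)
    have 3: "2 * (p + 1 + (q - 1)) - 1 = 2 * (p + q) - 1" by simp
    show ?thesis
      unfolding beta_kernel_def 1 2 3 by simp
  qed (simp add: beta_kernel_def)
  then show "beta_kernel (p + 1) q s - beta_kernel p q s = beta_kernel (p + 1) (q - 1) s"
    and "beta_kernel (p + 1) q s = s\<^sup>2 * beta_kernel p q s"
    by (auto simp: algebra_simps)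
qed

text \<open>Multiplication by \<open>s^2 - 1\<close> takes \<open>(p, q)\<close> to
  \<open>(p + 1, q - 1)\<close>, as \<open>p + q\<close> is unchanged. Eliminating that integral by
  the recurrence in \<open>q\<close> leaves a relation between \<open>p\<close> and
  \<open>p + 1\<close>.\<close>

lemma contour_integral_beta_kernel_Suc_left:
  assumes w: "1 < Re w" "0 < Im w" and pq: "1/2 < p + q"
  shows "of_real (p + 1) * contour_integral (triangle_path w) (beta_kernel (p + 1) q) =
    of_real (p + q) * contour_integral (triangle_path w) (beta_kernel p q)"
proof -
  let ?L = "\<lambda>p q. contour_integral (triangle_path w) (beta_kernel p q)"
  have "?L (p + 1) (q - 1) = contour_integral (triangle_path w) (\<lambda>s. beta_kernel (p + 1) q s - beta_kernel p q s)"
    using beta_kernel_Suc_left(1) path_image_triangle_path_subset[OF w]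
    by (intro contour_integral_cong) auto
  also have "\<dots> = ?L (p + 1) q - ?L p q"
    using pq by (intro contour_integral_diff contour_integrable_beta_kernel w) auto
  finally have 1: "?L (p + 1) (q - 1) = ?L (p + 1) q - ?L p q" .
  have "of_real (p + q) * ?L (p + 1) (q - 1) = of_real (q - 1) * ?L (p + 1) q"
    using contour_integral_beta_kernel_Suc_right[OF w, of "p + 1" "q - 1"] pq by (simp add: add_ac)
  then show ?thesis unfolding 1 by (simp add: algebra_simps)
qed

lemma one_in_interior_triangle:
  assumes "1 < Re w" "0 < Im w"
  shows "1 \<in> interior (convex hull {0, cnj w, w})"
proof -
  have nc: "\<not> collinear {0, cnj w, w}"
  proof
    assume "collinear {0, cnj w, w}"
    then obtain c where c: "w = c *\<^sub>R cnj w"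
      using assms by (auto simp: collinear_lemma)
    have "Re w = c * Re w" "Im w = - c * Im w"
      using arg_cong[OF c, of Re] arg_cong[OF c, of Im] by simp_all
    then show False using assms by simp
  qed
  \<comment> \<open>As \<open>cnj w + w = 2 * Re w\<close>, equal weights
    \<open>1 / (2 * Re w)\<close> at the conjugate vertices represent \<open>1\<close>; the
    remaining weight falls on the vertex \<open>0\<close>.\<close>
  show ?thesis
    unfolding interior_convex_hull_3_minimal[OF nc DIM_complex]
    using assms
    by (intro CollectI exI[of _ "1 - 1 / Re w"] exI[of _ "1 / (2 * Re w)"])
      (auto simp: complex_eq_iff field_simps)
qed

text \<open>For \<open>q = 1\<close> the second factor is rational, so the cut between
  \<open>0\<close> and \<open>1\<close> shrinks to a simple pole at \<open>1\<close>, with residue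
  \<open>f 1 = 1\<close>. The origin lies on the boundary of \<open>S\<close>, where continuity of
  \<open>f\<close> suffices.\<close>

lemma contour_integral_beta_kernel_one:
  assumes w: "1 < Re w" "0 < Im w" and p: "0 < p"
  shows "contour_integral (triangle_path w) (beta_kernel p 1) = 2 * of_real pi * \<i>"
proof -
  define S where "S = {s. 0 \<le> Re s}"
  have intS: "interior S = {s. 0 < Re s}"
    using interior_halfspace_ge[of "1::complex" 0] by (simp add: S_def inner_complex_def)
  define f where "f = (\<lambda>s::complex. 2 * s powr of_real (2 * p + 1) / (s + 1))"
  have ne: "s + 1 \<noteq> 0" if "0 \<le> Re s" for s
    using that by (metis Re_complex_of_real add_nonneg_pos less_irrefl of_real_1 plus_complex.sel(1) zero_complex.sel(1) zero_less_one)
  have w1: "winding_number (triangle_path w) 1 = 1"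
    unfolding triangle_path_def winding_number_triangle[OF one_in_interior_triangle[OF w]]
    using w by (simp add: algebra_simps)
  have "((\<lambda>s. f s / (s - 1)) has_contour_integral
      complex_of_real (2 * pi) * \<i> * winding_number (triangle_path w) 1 * f 1) (triangle_path w)"
  proof (rule Cauchy_integral_formula_weak[where S = S and k = "{}"])
    show "convex S" unfolding S_def by (rule convex_halfspace_Re_ge)
    show "continuous_on S f"
      unfolding f_def
      by (intro continuous_intros continuous_on_powr_complex) (use p ne in \<open>auto simp: S_def\<close>)
    show "f field_differentiable at s" if "s \<in> interior S - {}" for s
    proof -
      have "(\<lambda>s. s powr of_real (2 * p + 1)) field_differentiable at s"
        unfolding field_differentiable_def
        by (rule exI, rule has_field_derivative_powr)
          (use that in \<open>auto simp: intS complex_nonpos_Reals_iff\<close>)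
      then show ?thesis
        unfolding f_def using ne[of s] that
        by (intro field_differentiable_divide field_differentiable_mult field_differentiable_const
            field_differentiable_add field_differentiable_ident) (auto simp: intS)
    qed
    show "1 \<in> interior S - {}" by (simp add: intS)
    show "path_image (triangle_path w) \<subseteq> S - {1}"
      using path_image_triangle_path_subset[OF w] by (auto simp: S_def slit_halfplane_def)
  qed auto
  moreover have "f 1 = 1" by (simp add: f_def)
  moreover have "beta_kernel p 1 s = f s / (s - 1)" if "s \<in> path_image (triangle_path w)" for s
  proof (cases "s = 0")
    case False
    then have s: "s \<in> slit_halfplane" using that path_image_triangle_path_subset[OF w] by auto
    have "s\<^sup>2 - 1 \<noteq> 0"
      using slit_halfplane_nonpos_Reals[OF s] by auto
    moreover have "s\<^sup>2 - 1 = (s + 1) * (s - 1)" by (simp add: power2_eq_square algebra_simps)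
    ultimately have "(s\<^sup>2 - 1) powr (- 1) = 1 / ((s + 1) * (s - 1))"
      by (simp add: powr_minus divide_inverse)
    then show ?thesis by (simp add: beta_kernel_def f_def add.commute)
  qed (simp add: beta_kernel_def f_def)
  ultimately have "(beta_kernel p 1 has_contour_integral complex_of_real (2 * pi) * \<i> * 1 * 1) (triangle_path w)"
    using w1 by (auto intro: has_contour_integral_eq)
  then show ?thesis
    using contour_integral_unique by fastforce
qed

section \<open>Collapse of the loop onto the cut and its evaluation\<close>

lemma interior_subset_halfspace:
  fixes a :: "'a::euclidean_space"
  assumes "S \<subseteq> {x. b \<le> a \<bullet> x}" "a \<noteq> 0" "x \<in> interior S"
  shows "b < a \<bullet> x"
  using interior_mono[OF assms(1)] interior_halfspace_ge[OF assms(2), of b] assms(3) by auto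

lemma contour_integral_three_linepaths:
  assumes "(f has_contour_integral 0) (linepath a b +++ linepath b c +++ linepath c a)"
  shows "contour_integral (linepath b c) f + contour_integral (linepath c a) f = - contour_integral (linepath a b) f"
  using has_chain_integral_chain_integral3[OF assms] by (simp add: algebra_simps add_eq_0_iff)

text \<open>Euler's integral under \<open>t = x^2\<close>. It is used with
  \<open>a = p + q - 1\<close> and \<open>b = - q\<close>; positive exponents keep the integrand
  continuous on the closed interval, as the substitution rule demands.\<close>

lemma has_contour_integral_Beta_segment:
  assumes "0 < a" "0 < b"
  shows "((\<lambda>s. 2 * s powr of_real (2 * a + 1) * (1 - s\<^sup>2) powr of_real b)
    has_contour_integral of_real (Beta (a + 1) (b + 1))) (linepath 0 1)"
proof -
  have cont: "continuous_on {0..1} (\<lambda>t::real. t powr a * (1 - t) powr b)"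
    using assms by (intro continuous_intros continuous_on_powr') auto
  have "integral {0..1} (\<lambda>t. t powr a * (1 - t) powr b) = Beta (a + 1) (b + 1)"
    using has_integral_Beta_real[of "a + 1" "b + 1"] assms by (simp add: integral_unique)
  moreover have "((\<lambda>x. (2 * x) *\<^sub>R (x\<^sup>2 powr a * (1 - x\<^sup>2) powr b)) has_integral
      integral {0\<^sup>2..1\<^sup>2} (\<lambda>t. t powr a * (1 - t) powr b)) {0..1}"
    by (rule has_integral_substitution[OF _ _ _ cont])
      (auto intro!: derivative_eq_intros simp: power_le_one)
  ultimately have *: "((\<lambda>x. (2 * x) * (x\<^sup>2 powr a * (1 - x\<^sup>2) powr b)) has_integral Beta (a + 1) (b + 1)) {0..1}"
    by simp
  have "((\<lambda>x. complex_of_real ((2 * x) * (x\<^sup>2 powr a * (1 - x\<^sup>2) powr b))) has_integral of_real (Beta (a + 1) (b + 1))) {0..1}"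
    by (rule has_integral_complex_of_real[OF *])
  moreover have "complex_of_real ((2 * x) * (x\<^sup>2 powr a * (1 - x\<^sup>2) powr b)) =
      2 * of_real x powr of_real (2 * a + 1) * (1 - (of_real x)\<^sup>2) powr of_real b" if "x \<in> {0..1}" for x
  proof -
    have "(2 * x) * (x\<^sup>2 powr a * (1 - x\<^sup>2) powr b) = 2 * x powr (2 * a + 1) * (1 - x\<^sup>2) powr b"
    proof (cases "x = 0")
      case False
      then have "x > 0" using that by simp
      then have "x\<^sup>2 = x powr 2" by simp
      then have "x\<^sup>2 powr a = x powr (2 * a)" by (simp add: powr_powr del: powr_numeral)
      then show ?thesis using \<open>x > 0\<close> by (simp add: powr_add)
    qed simp
    moreover have "of_real x powr complex_of_real (2 * a + 1) = complex_of_real (x powr (2 * a + 1))"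
      using that by (intro powr_of_real) simp
    moreover have "(1 - (complex_of_real x)\<^sup>2) powr complex_of_real b = complex_of_real ((1 - x\<^sup>2) powr b)"
      using that powr_of_real[of "1 - x\<^sup>2" b] by (simp add: power_le_one)
    ultimately show ?thesis by (simp only: of_real_mult of_real_numeral)
  qed
  ultimately have "((\<lambda>x. 2 * of_real x powr of_real (2 * a + 1) * (1 - (of_real x)\<^sup>2) powr of_real b) has_integral
      complex_of_real (Beta (a + 1) (b + 1))) {0..1}"
    by (rule has_integral_eq[rotated])
  then show ?thesis
    by (subst has_contour_integral_linepath_Reals_iff) auto
qed

text \<open>The triangle \<open>0, 1, w\<close> deforms the two sides at \<open>w\<close> onto the bank of the cut on which \<open>w\<close> lies.\<close>
lemma beta_kernel_bank:
  fixes \<epsilon> :: real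
  assumes w: "1 < Re w" "0 < \<epsilon> * Im w" and \<epsilon>: "\<epsilon> = 1 \<or> \<epsilon> = -1" and q: "q < 0" "1 < p + q"
  shows "contour_integral (linepath 1 w) (beta_kernel p q) + contour_integral (linepath w 0) (beta_kernel p q)
    = - exp (- (\<i> * of_real (\<epsilon> * pi * q))) * of_real (Beta (p + q) (1 - q))"
proof -
  \<comment> \<open>Replacing \<open>s^2 - 1\<close> by \<open>1 - s^2\<close> moves the cut from
    \<open>(0, 1)\<close> to the real axis beyond \<open>1\<close>, so that \<open>f\<close> is
    continuous on the closed triangle.\<close>
  define f where "f = (\<lambda>s::complex. 2 * s powr of_real (2 * (p + q - 1) + 1) * (1 - s\<^sup>2) powr of_real (- q))"
  \<comment> \<open>The third half-plane is bounded by the line through \<open>1\<close> and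
    \<open>w\<close>. It confines the real points of \<open>A\<close> to \<open>[0, 1]\<close>, away
    from the cut of \<open>f\<close>.\<close>
  define A where "A = {s. 0 \<le> 1 \<bullet> s} \<inter> {s. 0 \<le> (\<epsilon> *\<^sub>R \<i>) \<bullet> s} \<inter>
     {s. - (\<epsilon> * Im w) \<le> ((\<epsilon> * (Re w - 1)) *\<^sub>R \<i> - of_real (\<epsilon> * Im w)) \<bullet> s}"
  have A: "s \<in> A \<longleftrightarrow> 0 \<le> Re s \<and> 0 \<le> \<epsilon> * Im s \<and> \<epsilon> * Im w * (Re s - 1) \<le> \<epsilon> * (Re w - 1) * Im s" for s
    by (auto simp: A_def inner_complex_def algebra_simps)
  have "convex A"
    unfolding A_def by (intro convex_Int convex_halfspace_ge)
  then have hull: "convex hull {0, 1, w} \<subseteq> A"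
    using w \<epsilon> by (intro hull_minimal) (auto simp: A)
  have re: "Re s \<le> 1" if "s \<in> A" "Im s = 0" for s
  proof (rule ccontr)
    assume "\<not> Re s \<le> 1"
    then have "0 < \<epsilon> * Im w * (Re s - 1)" by (intro mult_pos_pos[OF w(2)]) simp
    then show False using that by (simp add: A)
  qed
  have contf: "continuous_on A f"
  proof -
    have "0 \<le> Re (1 - s\<^sup>2) \<or> Im (1 - s\<^sup>2) \<noteq> 0" if "s \<in> A" for s
    proof (cases "Im s = 0")
      case True
      then show ?thesis using re[OF that] that
        by (simp add: A power2_eq_square mult_le_one)
    next
      case False
      then show ?thesis
        by (auto simp: power2_eq_square) (smt (verit) zero_le_square)
    qed
    then have "A \<subseteq> {s. 0 \<le> Re (1 - s\<^sup>2) \<or> Im (1 - s\<^sup>2) \<noteq> 0}" by blast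
    moreover have "A \<subseteq> {s. 0 \<le> Re s \<or> Im s \<noteq> 0}" by (auto simp: A)
    ultimately show ?thesis
      unfolding f_def
      by (intro continuous_intros continuous_on_powr_complex) (use q in simp_all)
  qed
  have "(f has_contour_integral 0) (linepath 0 1 +++ linepath 1 w +++ linepath w 0)"
  proof (rule Cauchy_theorem_triangle_interior)
    show "continuous_on (convex hull {0, 1, w}) f"
      using contf hull by (rule continuous_on_subset)
    show "f holomorphic_on interior (convex hull {0, 1, w})"
    proof -
      have s: "0 < Re s" "0 < \<epsilon> * Im s" if "s \<in> interior (convex hull {0, 1, w})" for s
        using interior_subset_halfspace[OF _ _ that, of 0 1] interior_subset_halfspace[OF _ _ that, of 0 "\<epsilon> *\<^sub>R \<i>"]
          hull \<epsilon> by (auto simp: A_def inner_complex_def)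
      then show ?thesis
        unfolding f_def
        by (intro holomorphic_intros)
          (fastforce simp: complex_nonpos_Reals_iff power2_eq_square)+
    qed
  qed
  from contour_integral_three_linepaths[OF this]
  have sumf: "contour_integral (linepath 1 w) f + contour_integral (linepath w 0) f = - of_real (Beta (p + q) (1 - q))"
    using contour_integral_unique[OF has_contour_integral_Beta_segment[of "p + q - 1" "- q"]] q
    by (simp add: f_def)
  have eq: "beta_kernel p q s = exp (- (\<i> * of_real (\<epsilon> * pi * q))) * f s"
    if "s \<in> closed_segment 1 w \<union> closed_segment w 0" for s
  proof -
    have ex: "2 * (p + q - 1) + 1 = 2 * (p + q) - 1" by simp
    show ?thesis
    proof (cases "s = 0 \<or> s = 1")
      case True
      then show ?thesis by (auto simp: beta_kernel_def f_def)
    next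
      case False
      have "0 < Re s \<and> 0 < \<epsilon> * Im s"
      proof (cases "s \<in> closed_segment 1 w")
        case True
        then obtain u where u: "0 \<le> u" "u \<le> 1" "s = (1 - u) *\<^sub>R 1 + u *\<^sub>R w"
          by (auto simp: closed_segment_def)
        then have "0 < u" using False by (cases "u = 0") auto
        then have "0 < u * (\<epsilon> * Im w)" "0 < u * (Re w - 1)" using w by simp_all
        moreover have "Re s = 1 + u * (Re w - 1)" "\<epsilon> * Im s = u * (\<epsilon> * Im w)"
          unfolding u(3) by (simp_all add: right_diff_distrib)
        ultimately show ?thesis by linarith
      next
        case notin: False
        then have "s \<in> closed_segment w 0" using that by blast
        then obtain u where u: "0 \<le> u" "u \<le> 1" "s = (1 - u) *\<^sub>R w"
          by (auto simp: closed_segment_def)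
        then have "u < 1" using False by (cases "u = 1") auto
        then have "0 < (1 - u) * (\<epsilon> * Im w)" "0 < (1 - u) * Re w" using w by simp_all
        moreover have "Re s = (1 - u) * Re w" "\<epsilon> * Im s = (1 - u) * (\<epsilon> * Im w)"
          unfolding u(3) by simp_all
        ultimately show ?thesis by linarith
      qed
      then have "0 < Re s * (\<epsilon> * Im s)" by simp
      moreover have "Im (1 - s\<^sup>2) * \<epsilon> = - 2 * (Re s * (\<epsilon> * Im s))"
        by (simp add: power2_eq_square)
      ultimately have "Im (1 - s\<^sup>2) * \<epsilon> < 0" by linarith
      then have "Im (1 - s\<^sup>2) * \<epsilon> < 0" "1 - s\<^sup>2 \<noteq> 0" by auto
      \<comment> \<open>The sign of \<open>Im (1 - s^2)\<close> is opposite to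
        \<open>\<epsilon>\<close>, so negation turns the argument by \<open>\<epsilon> * pi\<close>.
        This is the constant phase of the bank.\<close>
      then have "Ln (- (1 - s\<^sup>2)) = Ln (1 - s\<^sup>2) + \<i> * of_real (\<epsilon> * pi)"
        using \<epsilon> by (subst Ln_minus) auto
      then have "(s\<^sup>2 - 1) powr of_real (- q) = exp (- (\<i> * of_real (\<epsilon> * pi * q))) * (1 - s\<^sup>2) powr of_real (- q)"
        using \<open>1 - s\<^sup>2 \<noteq> 0\<close> by (auto simp: powr_def exp_add[symmetric] algebra_simps)
      then show ?thesis
        unfolding beta_kernel_def f_def ex by (simp add: algebra_simps)
    qed
  qed
  have scale: "contour_integral (linepath a b) (beta_kernel p q) = exp (- (\<i> * of_real (\<epsilon> * pi * q))) * contour_integral (linepath a b) f"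
    if ab: "closed_segment a b \<subseteq> closed_segment 1 w \<union> closed_segment w 0" for a b
  proof -
    have "closed_segment a b \<subseteq> A"
      using ab hull segment_convex_hull[of 1 w] segment_convex_hull[of w 0]
        hull_mono[of "{1, w}" "{0, 1, w}"] hull_mono[of "{w, 0}" "{0, 1, w}"] by blast
    then have "f contour_integrable_on linepath a b"
      by (intro contour_integrable_continuous_linepath continuous_on_subset[OF contf])
    then have "contour_integral (linepath a b) (\<lambda>s. exp (- (\<i> * of_real (\<epsilon> * pi * q))) * f s) =
        exp (- (\<i> * of_real (\<epsilon> * pi * q))) * contour_integral (linepath a b) f"
      by (rule contour_integral_lmul)
    moreover have "contour_integral (linepath a b) (beta_kernel p q) =
        contour_integral (linepath a b) (\<lambda>s. exp (- (\<i> * of_real (\<epsilon> * pi * q))) * f s)"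
      using ab eq by (intro contour_integral_cong) auto
    ultimately show ?thesis by simp
  qed
  show ?thesis
    using sumf unfolding scale[OF Un_upper1] scale[OF Un_upper2] distrib_left[symmetric] by simp
qed

text \<open>The triangle \<open>cnj w, 1, w\<close> meets no cut, so the vertical side may be drawn
  back to pass through \<open>1\<close>. What remains is one integral for each bank, with opposite
  phases, and their difference produces the sine.\<close>

lemma contour_integral_beta_kernel_negative:
  assumes w: "1 < Re w" "0 < Im w" and q: "q < 0" "1 < p + q"
  shows "contour_integral (triangle_path w) (beta_kernel p q)
    = 2 * \<i> * of_real (sin (pi * q) * Beta (p + q) (1 - q))"
proof -
  let ?I = "\<lambda>a b. contour_integral (linepath a b) (beta_kernel p q)"
  let ?B = "complex_of_real (Beta (p + q) (1 - q))"
  define H where "H = {s::complex. 1 \<le> 1 \<bullet> s}"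
  have H: "s \<in> H \<longleftrightarrow> 1 \<le> Re s" for s by (simp add: H_def inner_complex_def)
  have "convex H" unfolding H_def by (rule convex_halfspace_ge)
  then have hull: "convex hull {cnj w, 1, w} \<subseteq> H"
    using w by (intro hull_minimal) (auto simp: H)
  have contH: "continuous_on H (beta_kernel p q)"
  proof -
    have "0 \<le> Re (s\<^sup>2 - 1) \<or> Im (s\<^sup>2 - 1) \<noteq> 0" if "s \<in> H" for s
      using that mult_mono[of 1 "Re s" 1 "Re s"] by (auto simp: H power2_eq_square)
    then have "H \<subseteq> {s. 0 \<le> Re (s\<^sup>2 - 1) \<or> Im (s\<^sup>2 - 1) \<noteq> 0}" by blast
    then show ?thesis
      unfolding beta_kernel_def
      by (intro continuous_intros continuous_on_powr_complex) (use q in \<open>auto simp: H\<close>)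
  qed
  have "(beta_kernel p q has_contour_integral 0) (linepath (cnj w) 1 +++ linepath 1 w +++ linepath w (cnj w))"
  proof (rule Cauchy_theorem_triangle_interior)
    show "continuous_on (convex hull {cnj w, 1, w}) (beta_kernel p q)"
      using contH hull by (rule continuous_on_subset)
    have "1 < Re s" if "s \<in> interior (convex hull {cnj w, 1, w})" for s
      using interior_subset_halfspace[OF _ _ that, of 1 1] hull by (auto simp: H_def inner_complex_def)
    then have "interior (convex hull {cnj w, 1, w}) \<subseteq> slit_halfplane"
      by (fastforce simp: slit_halfplane_def)
    then show "beta_kernel p q holomorphic_on interior (convex hull {cnj w, 1, w})"
      unfolding beta_kernel_def mult.assoc
      by (intro holomorphic_on_mult holomorphic_on_const holomorphic_on_subset[OF holomorphic_powr_product])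
  qed
  then have 1: "?I (cnj w) 1 + ?I 1 w + ?I w (cnj w) = 0"
    by (rule has_chain_integral_chain_integral3)
  have 2: "?I 1 w + ?I w 0 = - exp (- (\<i> * of_real (1 * pi * q))) * ?B"
    by (rule beta_kernel_bank) (use w q in auto)
  have 3: "?I 1 (cnj w) + ?I (cnj w) 0 = - exp (- (\<i> * of_real (- 1 * pi * q))) * ?B"
    by (rule beta_kernel_bank) (use w q in auto)
  have contT: "continuous_on (path_image (triangle_path w)) (beta_kernel p q)"
    using q by (intro continuous_on_subset[OF continuous_on_beta_kernel path_image_triangle_path_subset] w) simp
  have rev: "?I (cnj w) 1 = - ?I 1 (cnj w)" "?I 0 (cnj w) = - ?I (cnj w) 0" "?I (cnj w) w = - ?I w (cnj w)"
  proof -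
    have "closed_segment 1 (cnj w) \<subseteq> H"
      using w \<open>convex H\<close> by (intro closed_segment_subset) (auto simp: H)
    then show "?I (cnj w) 1 = - ?I 1 (cnj w)"
      by (intro contour_integral_reverse_linepath continuous_on_subset[OF contH])
        (simp add: closed_segment_commute)
    show "?I 0 (cnj w) = - ?I (cnj w) 0" "?I (cnj w) w = - ?I w (cnj w)"
      by (intro contour_integral_reverse_linepath continuous_on_subset[OF contT];
          auto simp: path_image_triangle_path)+
  qed
  have "contour_integral (triangle_path w) (beta_kernel p q) = ?I 0 (cnj w) + ?I (cnj w) w + ?I w 0"
    by (rule contour_integral_triangle_path[OF contT])
  also have "\<dots> = (?I 1 w + ?I w 0) - (?I 1 (cnj w) + ?I (cnj w) 0)"
    using 1 unfolding rev by (simp add: algebra_simps add_eq_0_iff)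
  also have "\<dots> = (exp (\<i> * of_real (pi * q)) - exp (- (\<i> * of_real (pi * q)))) * ?B"
    unfolding 2 3 by (simp add: algebra_simps)
  also have "exp (\<i> * of_real (pi * q)) - exp (- (\<i> * of_real (pi * q))) = 2 * \<i> * of_real (sin (pi * q))"
    by (simp add: sin_of_real[symmetric] sin_exp_eq field_simps del: of_real_mult)
  finally show ?thesis by simp
qed

text \<open>For \<open>-1 < q < 0\<close> the integrand is bounded near \<open>1\<close> and the contour collapses onto the cut. The
  recurrence \<open>(p + q) L(p, q) = q L(p, q + 1)\<close> reaches all non-integral \<open>q > 0\<close> from there, but it
  cannot pass \<open>q = 0\<close>, so that \<open>q = 1\<close> needs Cauchy's formula. The collapse requires \<open>p + q > 1\<close>;
  the recurrence in \<open>p\<close> removes this restriction.\<close>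
lemma contour_integral_beta_kernel:
  assumes w: "1 < Re w" "0 < Im w" and pq: "0 < p" "0 < q" "1/2 < p + q"
  shows "contour_integral (triangle_path w) (beta_kernel p q)
    = 2 * of_real pi * \<i> * of_real (Gamma (p + q) / (Gamma q * Gamma (p + 1)))"
proof -
  let ?L = "\<lambda>p q. contour_integral (triangle_path w) (beta_kernel p q)"
  let ?R = "\<lambda>p q. 2 * of_real pi * \<i> * complex_of_real (Gamma (p + q) / (Gamma q * Gamma (p + 1)))"
  have pos: "x \<notin> \<int>\<^sub>\<le>\<^sub>0" if "0 < x" for x :: real
    using that nonpos_Ints_nonpos[of x] by auto
  have neg: "x \<notin> \<int>\<^sub>\<le>\<^sub>0" if "-1 < x" "x < 0" for x :: real
    using that by (auto elim!: nonpos_Ints_cases)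
  \<comment> \<open>The bound \<open>2 \<le> p\<close> ensures \<open>p + r > 1\<close> for every
    \<open>r > -1\<close>, as the collapse requires.\<close>
  have unit: "?L p q = ?R p q" if "2 \<le> p" "0 < q" "q < 1" for p q :: real
  proof -
    define r where "r = q - 1"
    have r: "-1 < r" "r < 0" "1 < p + r" and q: "q = r + 1" using that by (auto simp: r_def)
    have "Gamma (complex_of_real r) * Gamma (1 - of_real r) = of_real pi / sin (of_real pi * of_real r)"
      by (rule Gamma_reflection_complex)
    then have "complex_of_real (Gamma r * Gamma (1 - r)) = of_real (pi / sin (pi * r))"
      using Gamma_complex_of_real[of "1 - r"]
      by (simp add: Gamma_complex_of_real sin_of_real[symmetric] del: sin_of_real)
    then have refl: "Gamma r * Gamma (1 - r) = pi / sin (pi * r)"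
      using of_real_eq_iff by blast
    have G: "Gamma (r + 1) = r * Gamma r" "Gamma (p + r + 1) = (p + r) * Gamma (p + r)"
      using r neg pos by (auto intro!: Gamma_plus1)
    have nz: "Gamma r \<noteq> 0" "Gamma (1 - r) \<noteq> 0"
      using r neg pos by (auto simp: Gamma_eq_zero_iff)
    then have "sin (pi * r) \<noteq> 0" using refl by auto
    \<comment> \<open>By the reflection formula the sine cancels \<open>Gamma (1 - r)\<close> in
      \<open>Beta (p + r) (1 - r)\<close> and leaves \<open>Gamma r\<close> in the
      denominator.\<close>
    then have s: "sin (pi * r) = pi / (Gamma r * Gamma (1 - r))" using refl nz by (simp add: field_simps)
    have "of_real r * ?L p q = of_real (p + r) * (2 * \<i> * of_real (sin (pi * r) * Beta (p + r) (1 - r)))"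
      using contour_integral_beta_kernel_Suc_right[OF w, of p r]
        contour_integral_beta_kernel_negative[OF w, of r p] r by (simp add: q)
    also have "\<dots> = 2 * of_real pi * \<i> * of_real ((p + r) * Gamma (p + r) / (Gamma r * Gamma (p + 1)))"
      unfolding s Beta_def using nz by (simp add: field_simps)
    also have "\<dots> = of_real r * ?R p q"
      using G r nz by (simp add: q add.assoc[symmetric])
    finally show ?thesis unfolding mult_cancel_left using r by auto
  qed
  have base: "?L p q = ?R p q" if "2 \<le> p" "0 < q" "q \<le> 1" for p q :: real
  proof (cases "q = 1")
    case True
    have "Gamma (p + 1) \<noteq> 0" using pos[of "p + 1"] that by (simp add: Gamma_eq_zero_iff)
    then show ?thesis using True contour_integral_beta_kernel_one[OF w, of p] that by simp
  qed (use unit that in auto)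
  have shift: "?L p (q + real m) = ?R p (q + real m)" if "2 \<le> p" "0 < q" "q \<le> 1" for p q m
  proof (induction m)
    case 0
    show ?case using base[OF that] by simp
  next
    case (Suc m)
    define r where "r = q + real m"
    have r: "0 < r" "q + real (Suc m) = r + 1" using that by (auto simp: r_def)
    have G: "Gamma (r + 1) = r * Gamma r" "Gamma (p + r + 1) = (p + r) * Gamma (p + r)"
      using r that by (auto intro!: Gamma_plus1 pos)
    have "of_real r * ?L p (r + 1) = of_real (p + r) * ?R p r"
      using contour_integral_beta_kernel_Suc_right[OF w, of p r] Suc.IH r that by (simp add: r_def)
    also have "\<dots> = of_real r * ?R p (r + 1)"
      using G r by (simp add: add.assoc[symmetric])
    finally show ?case unfolding mult_cancel_left r using r by auto
  qed
  have large: "?L p q = ?R p q" if "2 \<le> p" "0 < q" for p q :: real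
  proof -
    \<comment> \<open>This choice puts \<open>q - real m\<close> into \<open>(0, 1]\<close>;
      integral \<open>q\<close> thus reduces to the case \<open>q = 1\<close>.\<close>
    define m where "m = nat (\<lceil>q\<rceil> - 1)"
    have "real m = of_int \<lceil>q\<rceil> - 1" using that by (simp add: m_def)
    then have "0 < q - real m" "q - real m \<le> 1" by linarith+
    from shift[OF that(1) this, of m] show ?thesis by simp
  qed
  have down: "?L p q = ?R p q" if "?L (p + 1) q = ?R (p + 1) q" "0 < p" "0 < q" "1/2 < p + q" for p q
  proof -
    have G: "Gamma (p + 1 + 1) = (p + 1) * Gamma (p + 1)" "Gamma (p + q + 1) = (p + q) * Gamma (p + q)"
      using that by (intro Gamma_plus1 pos; simp)+
    have "of_real (p + q) * ?L p q = of_real (p + 1) * ?R (p + 1) q"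
      using contour_integral_beta_kernel_Suc_left[OF w, of p q] that by simp
    also have "\<dots> = of_real (p + q) * ?R p q"
    proof -
      have "complex_of_real (1 + p) \<noteq> 0" using that by (simp only: of_real_eq_0_iff)
      then show ?thesis using G by (simp add: add_ac)
    qed
    finally have "complex_of_real (p + q) = 0 \<or> ?L p q = ?R p q"
      by (simp only: mult_cancel_left)
    moreover have "complex_of_real (p + q) \<noteq> 0" using that by (simp only: of_real_eq_0_iff)
    ultimately show ?thesis by blast
  qed
  \<comment> \<open>Two steps are enough, since \<open>p + 2\<close> always lies in the range of
    \<open>large\<close>.\<close>
  have "?L (p + 1 + 1) q = ?R (p + 1 + 1) q" using large pq by simp
  then have "?L (p + 1) q = ?R (p + 1) q" by (rule down) (use pq in auto)
  then show ?thesis by (rule down) (use pq in auto)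
qed

section \<open>The incomplete beta function\<close>

lemma inc_beta_integrable:
  fixes p q y :: real
  assumes "0 < p" "0 < q" "0 \<le> y" "y \<le> 1"
  shows "(\<lambda>t. t powr (p - 1) * (1 - t) powr (q - 1)) integrable_on {0..y}"
  by (rule integrable_subinterval_real[OF has_integral_integrable[OF has_integral_Beta_real[OF assms(1,2)]]])
    (use assms in auto)

lemma Beta_pos: "0 < p \<Longrightarrow> 0 < q \<Longrightarrow> 0 < (Beta p q :: real)"
  by (simp add: Beta_def)

text \<open>The derivative of \<open>t powr p * (1 - t) powr q\<close> is integrated over
  \<open>[0, y]\<close>. The coefficient is \<open>1 / (p * Beta p q)\<close> rewritten with Gamma
  functions, to match the value of the loop integral.\<close>

lemma inc_beta_recurrence:
  fixes p q y :: real
  assumes pq: "0 < p" "0 < q" and y: "0 < y" "y < 1"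
  shows "inc_beta y p q - inc_beta y (p + 1) q =
    y powr p * (1 - y) powr q * (Gamma (p + q) / (Gamma q * Gamma (p + 1)))"
proof -
  let ?f = "\<lambda>p t. t powr (p - 1) * (1 - t) powr (q - 1)"
  have 1: "((\<lambda>t. p * ?f p t - (p + q) * ?f (p + 1) t) has_integral
      y powr p * (1 - y) powr q - 0 powr p * (1 - 0) powr q) {0..y}"
  proof (rule fundamental_theorem_of_calculus_interior)
    show "continuous_on {0..y} (\<lambda>t. t powr p * (1 - t) powr q)"
      using pq y by (intro continuous_intros continuous_on_powr') auto
    fix t assume t: "t \<in> {0<..<y}"
    have e: "t powr p = t * t powr (p - 1)" "(1 - t) powr q = (1 - t) * (1 - t) powr (q - 1)"
      using t y by (simp_all add: powr_mult_base)
    have "((\<lambda>t. t powr p * (1 - t) powr q) has_real_derivative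
       p * t powr (p - 1) * (1 - t) powr q - t powr p * (q * (1 - t) powr (q - 1))) (at t)"
      using t y by (auto intro!: derivative_eq_intros)
    then have "((\<lambda>t. t powr p * (1 - t) powr q) has_real_derivative p * ?f p t - (p + q) * ?f (p + 1) t) (at t)"
      by (rule DERIV_cong) (simp add: e algebra_simps)
    then show "((\<lambda>t. t powr p * (1 - t) powr q) has_vector_derivative p * ?f p t - (p + q) * ?f (p + 1) t) (at t)"
      by (simp add: has_real_derivative_iff_has_vector_derivative)
  qed (use y in simp)
  have 2: "((\<lambda>t. p * ?f p t - (p + q) * ?f (p + 1) t) has_integral
      p * integral {0..y} (?f p) - (p + q) * integral {0..y} (?f (p + 1))) {0..y}"
    by (intro has_integral_diff has_integral_mult_right integrable_integral inc_beta_integrable)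
      (use pq y in auto)
  have I: "p * integral {0..y} (?f p) = y powr p * (1 - y) powr q + (p + q) * integral {0..y} (?f (p + 1))"
    using has_integral_unique[OF 1 2] by simp
  have pos: "p \<notin> \<int>\<^sub>\<le>\<^sub>0" using pq nonpos_Ints_nonpos[of p] by auto
  have B: "(p + q) * Beta (p + 1) q = p * Beta p q" "0 < Beta p q" "0 < Beta (p + 1) q"
    using Beta_plus1_left[OF pos] Beta_pos pq by auto
  have "inc_beta y p q = p * integral {0..y} (?f p) / (p * Beta p q)"
    using pq by (simp add: inc_beta_def)
  also have "\<dots> = y powr p * (1 - y) powr q / (p * Beta p q) + (p + q) * integral {0..y} (?f (p + 1)) / ((p + q) * Beta (p + 1) q)"
    unfolding I B(1) by (simp add: add_divide_distrib)
  also have "(p + q) * integral {0..y} (?f (p + 1)) / ((p + q) * Beta (p + 1) q) = inc_beta y (p + 1) q"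
    using pq by (simp add: inc_beta_def)
  finally show ?thesis
    using Gamma_plus1[OF pos] by (simp add: Beta_def)
qed

text \<open>The unnormalized integral is at most a constant times \<open>y ^ m\<close>, while
  consecutive values of \<open>Beta\<close> have a ratio tending to \<open>1\<close>. The ratio test
  shows that the quotient \<open>b\<close> is summable, which is more than convergence to
  \<open>0\<close>.\<close>

lemma inc_beta_tendsto_zero:
  fixes p q y :: real
  assumes pq: "0 < p" "0 < q" and y: "0 < y" "y < 1"
  shows "(\<lambda>m. inc_beta y (p + real m) q) \<longlonglongrightarrow> 0"
proof -
  let ?f = "\<lambda>p t. t powr (p - 1) * (1 - t) powr (q - 1)"
  define J where "J = integral {0..y} (?f p)"
  define b where "b = (\<lambda>m. J * y ^ m / Beta (p + real m) q)"
  have bound: "norm (inc_beta y (p + real m) q) \<le> b m" for m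
  proof -
    have "integral {0..y} (?f (p + real m)) \<le> integral {0..y} (\<lambda>t. y ^ m * ?f p t)"
    proof (rule integral_le)
      show "(\<lambda>t. y ^ m * ?f p t) integrable_on {0..y}"
        using inc_beta_integrable[OF pq, of y] y by (intro integrable_on_mult_right) auto
      fix t assume t: "t \<in> {0..y}"
      show "?f (p + real m) t \<le> y ^ m * ?f p t"
      proof (cases "t = 0")
        case False
        then have "?f (p + real m) t = t ^ m * ?f p t"
          using t by (simp add: powr_realpow[symmetric] powr_add[symmetric] algebra_simps)
        also have "\<dots> \<le> y ^ m * ?f p t"
          using t by (intro mult_right_mono power_mono) auto
        finally show ?thesis .
      qed simp
    qed (use inc_beta_integrable[of "p + real m" q y] pq y in auto)
    then have le: "integral {0..y} (?f (p + real m)) \<le> y ^ m * J"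
      by (simp add: J_def)
    have "0 \<le> integral {0..y} (?f (p + real m))"
      using inc_beta_integrable[of "p + real m" q y] pq y by (intro integral_nonneg) auto
    then show ?thesis
      using le Beta_pos[of "p + real m" q] pq
      by (simp add: inc_beta_def b_def divide_right_mono mult.commute)
  qed
  \<comment> \<open>The midpoint between the limiting ratio \<open>y\<close> and
    \<open>1\<close>.\<close>
  define c where "c = (1 + y) / 2"
  have "summable b"
  proof (rule summable_ratio_test)
    show "c < 1" using y by (simp add: c_def)
    \<comment> \<open>The threshold comes from solving \<open>y * (r + q) \<le> c * r\<close> for
      \<open>r\<close>.\<close>
    fix m assume m: "nat \<lceil>2 * y * q / (1 - y)\<rceil> \<le> m"
    define r where "r = p + real m"
    have r: "0 < r" using pq by (simp add: r_def)
    have "2 * y * q / (1 - y) \<le> real m" using m by linarith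
    also have "\<dots> \<le> r" using pq by (simp add: r_def)
    finally have "2 * y * q \<le> r * (1 - y)" using y by (simp add: field_simps)
    then have le: "y * (r + q) \<le> c * r"
      by (simp add: c_def algebra_simps)
    have "r \<notin> \<int>\<^sub>\<le>\<^sub>0" using r nonpos_Ints_nonpos[of r] by auto
    then have B: "(r + q) * Beta (r + 1) q = r * Beta r q" "0 < Beta r q" "0 < Beta (r + 1) q"
      using Beta_plus1_left Beta_pos pq r by auto
    have "b (Suc m) = J * y ^ m * (y * (r + q)) / ((r + q) * Beta (r + 1) q)"
    proof -
      have "b (Suc m) = J * y ^ m * y / Beta (r + 1) q" by (simp add: b_def r_def add_ac mult_ac)
      moreover have "r + q \<noteq> 0" using r pq by simp
      ultimately show ?thesis by simp
    qed
    also have "\<dots> = y * (r + q) / r * b m"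
      unfolding B(1) by (simp add: b_def r_def)
    finally have eq: "b (Suc m) = y * (r + q) / r * b m" .
    have "0 \<le> b m" using bound[of m] norm_ge_zero order_trans by blast
    moreover have "y * (r + q) / r \<le> c" using le r by (simp add: field_simps)
    ultimately show "norm (b (Suc m)) \<le> c * norm (b m)"
      using mult_right_mono[of "y * (r + q) / r" c "b m"] eq y r pq by (simp add: abs_mult)
  qed
  then show ?thesis
    using bound by (intro Lim_null_comparison[OF _ summable_LIMSEQ_zero]) auto
qed

text \<open>The Weierstrass test on the compact path image. It serves the geometric series in
  \<open>y * s^2\<close> and both parts of the series for
  \<open>exp (z^2) * erfc (- z)\<close>.\<close>

lemma contour_integral_triangle_path_sums:
  fixes a :: "nat \<Rightarrow> complex"
  assumes g: "continuous_on (path_image (triangle_path w)) g"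
    and v: "continuous_on (path_image (triangle_path w)) v"
    and bound: "\<And>s. s \<in> path_image (triangle_path w) \<Longrightarrow> cmod (v s) \<le> r"
    and sm: "summable (\<lambda>j. cmod (a j) * r ^ j)"
  shows "(\<lambda>j. a j * contour_integral (triangle_path w) (\<lambda>s. g s * v s ^ j)) sums
      contour_integral (triangle_path w) (\<lambda>s. g s * (\<Sum>j. a j * v s ^ j))"
    and "continuous_on (path_image (triangle_path w)) (\<lambda>s. g s * (\<Sum>j. a j * v s ^ j))"
proof -
  let ?P = "path_image (triangle_path w)"
  define f where "f = (\<lambda>j s. g s * (a j * v s ^ j))"
  define h where "h = (\<lambda>s. g s * (\<Sum>j. a j * v s ^ j))"
  have "compact ?P"
    by (intro compact_path_image valid_path_imp_path valid_triangle_path)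
  then have bg: "bounded (g ` ?P)"
    by (intro compact_imp_bounded compact_continuous_image g)
  then obtain G where G: "\<And>s. s \<in> ?P \<Longrightarrow> cmod (g s) \<le> G"
    unfolding bounded_iff by auto
  \<comment> \<open>A point of the path is needed to see that the bound \<open>G\<close> is
    nonnegative.\<close>
  have "0 \<in> ?P" by (simp add: path_image_triangle_path)
  then have "0 \<le> G" using G[of 0] norm_ge_zero[of "g 0"] by linarith
  have sv: "summable (\<lambda>j. a j * v s ^ j)" if "s \<in> ?P" for s
  proof (rule summable_comparison_test'[OF sm])
    show "norm (a j * v s ^ j) \<le> cmod (a j) * r ^ j" for j
      using bound[OF that] by (simp add: norm_mult norm_power mult_left_mono power_mono)
  qed
  have "uniform_limit ?P (\<lambda>N s. \<Sum>j<N. f j s) (\<lambda>s. \<Sum>j. f j s) sequentially"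
  proof (rule Weierstrass_m_test)
    show "summable (\<lambda>j. G * (cmod (a j) * r ^ j))" using sm by (rule summable_mult)
    show "norm (f j s) \<le> G * (cmod (a j) * r ^ j)" if "s \<in> ?P" for j s
      using bound[OF that] G[OF that] \<open>0 \<le> G\<close>
      by (auto simp: f_def norm_mult norm_power intro!: mult_mono power_mono)
  qed
  moreover have "(\<Sum>j. f j s) = h s" if "s \<in> ?P" for s
    unfolding f_def h_def using suminf_mult[OF sv[OF that]] by simp
  ultimately have ul: "uniform_limit ?P (\<lambda>N s. \<Sum>j<N. f j s) h sequentially"
    by (subst (asm) uniform_limit_cong'[OF refl]) auto
  have contf: "continuous_on ?P (f j)" for j
    unfolding f_def by (intro continuous_intros g v)
  have conth: "continuous_on ?P h"
    by (rule uniform_limit_theorem[OF _ ul])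
      (auto intro!: always_eventually continuous_on_sum contf)
  then show "continuous_on ?P (\<lambda>s. g s * (\<Sum>j. a j * v s ^ j))" by (simp add: h_def)
  have line: "(\<lambda>j. contour_integral (linepath b c) (f j)) sums contour_integral (linepath b c) h"
    if sub: "closed_segment b c \<subseteq> ?P" for b c
  proof -
    obtain J where "(h has_contour_integral J) (linepath b c)" "(\<lambda>j. contour_integral (linepath b c) (f j)) sums J"
      using contour_integral_sums_linepath[OF uniform_limit_on_subset[OF ul sub] continuous_on_subset[OF contf sub]] by metis
    then show ?thesis using contour_integral_unique by metis
  qed
  have "(\<lambda>j. contour_integral (triangle_path w) (f j)) sums contour_integral (triangle_path w) h"
    unfolding contour_integral_triangle_path[OF contf] contour_integral_triangle_path[OF conth]
    by (intro sums_add line) (auto simp: path_image_triangle_path)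
  moreover have "contour_integral (triangle_path w) (f j) = a j * contour_integral (triangle_path w) (\<lambda>s. g s * v s ^ j)" for j
  proof -
    have "(\<lambda>s. g s * v s ^ j) contour_integrable_on triangle_path w"
      by (intro contour_integrable_triangle_path continuous_intros g v)
    from contour_integral_lmul[OF this, of "a j"] show ?thesis
      by (simp add: f_def mult_ac)
  qed
  ultimately show "(\<lambda>j. a j * contour_integral (triangle_path w) (\<lambda>s. g s * v s ^ j)) sums
      contour_integral (triangle_path w) (\<lambda>s. g s * (\<Sum>j. a j * v s ^ j))"
    by (simp add: h_def)
qed

lemma norm_path_image_triangle_path:
  assumes "s \<in> path_image (triangle_path w)"
  shows "cmod s \<le> cmod w"
proof -
  have "path_image (triangle_path w) \<subseteq> cball 0 (cmod w)"
    unfolding path_image_triangle_path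
    by (intro Un_least closed_segment_subset convex_cball) auto
  then show ?thesis using assms by auto
qed

lemma beta_kernel_add_nat:
  "s \<in> insert 0 slit_halfplane \<Longrightarrow> beta_kernel (p + real j) q s = s ^ (2 * j) * beta_kernel p q s"
proof (induction j)
  case (Suc j)
  then show ?case
    using beta_kernel_Suc_left(2)[of s "p + real j" q] by (simp add: add_ac power2_eq_square)
qed simp

text \<open>Both sides are the sum of the series obtained by iterating
  \<open>I\<^sub>y(p, q) - I\<^sub>y(p + 1, q) = y\<^sup>p (1 - y)\<^sup>q \<Gamma>(p + q) / (\<Gamma>(q) \<Gamma>(p + 1))\<close>; on the contour side this is the geometric
  expansion of \<open>1 / (1 - y s\<^sup>2)\<close>.\<close>
lemma inc_beta_contour_integral:
  assumes w: "1 < Re w" "0 < Im w" and pq: "0 < p" "0 < q" "1/2 < p + q"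
    and y: "0 < y" "y < 1" and yw: "y * (cmod w)\<^sup>2 < 1"
  shows "complex_of_real (inc_beta y p q) = of_real (y powr p * (1 - y) powr q) / (2 * of_real pi * \<i>) *
    contour_integral (triangle_path w) (\<lambda>s. beta_kernel p q s / (1 - of_real y * s\<^sup>2))"
proof -
  let ?P = "path_image (triangle_path w)"
  define R where "R = (\<lambda>p. Gamma (p + q) / (Gamma q * Gamma (p + 1)))"
  have P: "?P \<subseteq> insert 0 slit_halfplane" by (rule path_image_triangle_path_subset[OF w])
  have contk: "continuous_on ?P (beta_kernel p q)"
    by (rule continuous_on_subset[OF continuous_on_beta_kernel[OF pq(3)] P])
  have small: "cmod (of_real y * s\<^sup>2) \<le> y * (cmod w)\<^sup>2" if "s \<in> ?P" for s
    using norm_path_image_triangle_path[OF that] y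
    by (auto simp: norm_mult norm_power intro!: mult_left_mono power_mono)
  have "(\<lambda>j. 1 * contour_integral (triangle_path w) (\<lambda>s. beta_kernel p q s * (of_real y * s\<^sup>2) ^ j)) sums
      contour_integral (triangle_path w) (\<lambda>s. beta_kernel p q s * (\<Sum>j. 1 * (of_real y * s\<^sup>2) ^ j))"
    by (rule contour_integral_triangle_path_sums(1)[OF contk _ small])
      (use yw y in \<open>auto intro!: continuous_intros summable_geometric\<close>)
  moreover have "contour_integral (triangle_path w) (\<lambda>s. beta_kernel p q s * (\<Sum>j. 1 * (of_real y * s\<^sup>2) ^ j)) =
      contour_integral (triangle_path w) (\<lambda>s. beta_kernel p q s / (1 - of_real y * s\<^sup>2))"
    using small yw by (intro contour_integral_cong refl) (force simp: suminf_geometric)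
  moreover have "contour_integral (triangle_path w) (\<lambda>s. beta_kernel p q s * (of_real y * s\<^sup>2) ^ j) =
      of_real (y ^ j) * (2 * of_real pi * \<i> * of_real (R (p + real j)))" for j
  proof -
    have "contour_integral (triangle_path w) (\<lambda>s. beta_kernel p q s * (of_real y * s\<^sup>2) ^ j) =
      contour_integral (triangle_path w) (\<lambda>s. of_real (y ^ j) * beta_kernel (p + real j) q s)"
      using P by (intro contour_integral_cong refl)
        (auto simp: beta_kernel_add_nat subset_iff power_mult_distrib power_mult)
    also have "\<dots> = of_real (y ^ j) * contour_integral (triangle_path w) (beta_kernel (p + real j) q)"
      using pq by (intro contour_integral_lmul contour_integrable_beta_kernel w) auto
    finally show ?thesis
      using contour_integral_beta_kernel[OF w, of "p + real j" q] pq by (simp add: R_def)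
  qed
  ultimately have "(\<lambda>j. of_real (y ^ j) * (2 * of_real pi * \<i> * of_real (R (p + real j)))) sums
     contour_integral (triangle_path w) (\<lambda>s. beta_kernel p q s / (1 - of_real y * s\<^sup>2))"
    by simp
  from sums_mult[OF this, of "of_real (y powr p * (1 - y) powr q) / (2 * of_real pi * \<i>)"]
  have 1: "(\<lambda>j. complex_of_real (y powr (p + real j) * (1 - y) powr q * R (p + real j))) sums
     (of_real (y powr p * (1 - y) powr q) / (2 * of_real pi * \<i>) *
       contour_integral (triangle_path w) (\<lambda>s. beta_kernel p q s / (1 - of_real y * s\<^sup>2)))"
    using y by (simp add: powr_add powr_realpow mult_ac)
  have "(\<lambda>j. inc_beta y (p + real j) q - inc_beta y (p + real (Suc j)) q) sums (inc_beta y (p + real 0) q - 0)"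
    by (rule telescope_sums'[OF inc_beta_tendsto_zero]) (use pq y in auto)
  moreover have "inc_beta y (p + real j) q - inc_beta y (p + real (Suc j)) q =
     y powr (p + real j) * (1 - y) powr q * R (p + real j)" for j
    using inc_beta_recurrence[of "p + real j" q y] pq y by (simp add: R_def add_ac)
  ultimately have "(\<lambda>j. y powr (p + real j) * (1 - y) powr q * R (p + real j)) sums inc_beta y p q"
    by simp
  from sums_of_real[OF this] have "(\<lambda>j. complex_of_real (y powr (p + real j) * (1 - y) powr q * R (p + real j))) sums of_real (inc_beta y p q)" .
  with 1 show ?thesis
    using sums_unique2 by blast
qed

section \<open>The noncentral t-distribution\<close>

text \<open>The argument of \<open>s\<close> stays below \<open>pi / 2\<close> in modulus, so
  doubling it does not leave the principal range.\<close>

lemma powr_square_right_halfplane: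
  assumes "0 < Re s"
  shows "(s\<^sup>2) powr a = s powr (2 * a)"
proof -
  have "s \<noteq> 0" using assms by auto
  then have "\<bar>Im (Ln s)\<bar> < pi / 2" using Re_Ln_pos_lt assms by blast
  then have "Ln (s\<^sup>2) = 2 * Ln s"
    using \<open>s \<noteq> 0\<close> by (intro Ln_unique) (auto simp: exp_double)
  then show ?thesis using \<open>s \<noteq> 0\<close> by (simp add: powr_def mult_ac)
qed

text \<open>The exponential and the \<open>erfc\<close> factor of \<open>nct_kernel\<close> at
  \<open>\<tau> = s^2\<close>, taken together because their product is entire in \<open>s\<close>
  and has the simple series of \<open>erfc_sums\<close>.\<close>

definition erfc_kernel :: "real \<Rightarrow> real \<Rightarrow> complex \<Rightarrow> complex" where
  "erfc_kernel \<delta> y s = (let z = of_real (\<delta> * sqrt (y / 2)) * s in exp (z\<^sup>2) * erfc (- z))"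

lemma holomorphic_erfc_kernel: "erfc_kernel \<delta> y holomorphic_on S"
  unfolding erfc_kernel_def Let_def
  by (intro holomorphic_intros holomorphic_on_compose_gen[OF _ holomorphic_erfc, unfolded o_def]) auto

text \<open>On the right half-plane the principal root of \<open>y/2 * s^2\<close> is
  \<open>sqrt (y/2) * s\<close>. The Jacobian \<open>2 * s\<close> raises the power of
  \<open>s\<close> from \<open>n - 1\<close> to \<open>n\<close>, which is the exponent in
  \<open>beta_kernel\<close> for \<open>p = 1/2\<close> and \<open>q = n/2\<close>.\<close>

lemma nct_kernel_square:
  assumes s: "s \<in> insert 0 slit_halfplane" and y: "0 < y"
  shows "2 * s * nct_kernel n \<delta> y (s\<^sup>2) = erfc_kernel \<delta> y s * beta_kernel (1/2) (n/2) s"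
proof (cases "s = 0")
  case False
  then have re: "0 < Re s" using s by (auto simp: slit_halfplane_def)
  have 1: "s * (s\<^sup>2) powr of_real (n/2 - 1/2) = s powr of_real (2 * (1/2 + n/2) - 1)"
  proof -
    have "s * (s\<^sup>2) powr of_real (n/2 - 1/2) = s powr 1 * s powr (2 * of_real (n/2 - 1/2))"
      unfolding powr_square_right_halfplane[OF re] using False by simp
    also have "\<dots> = s powr (1 + 2 * of_real (n/2 - 1/2))"
      by (rule powr_add[symmetric])
    finally show ?thesis by (simp add: algebra_simps)
  qed
  have 2: "csqrt (of_real (y / 2) * s\<^sup>2) = of_real (sqrt (y / 2)) * s"
  proof (rule csqrt_unique)
    have "(complex_of_real (sqrt (y / 2)))\<^sup>2 = of_real (y / 2)"
      using y by (simp flip: of_real_power)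
    then show "(of_real (sqrt (y / 2)) * s)\<^sup>2 = of_real (y / 2) * s\<^sup>2"
      by (simp only: power_mult_distrib)
  qed (use re y in simp)
  have 3: "(of_real (\<delta> * sqrt (y / 2)) * s)\<^sup>2 = of_real (\<delta>\<^sup>2 / 2 * y) * s\<^sup>2"
  proof -
    have "(\<delta> * sqrt (y / 2))\<^sup>2 = \<delta>\<^sup>2 / 2 * y"
      using y by (simp add: power_mult_distrib)
    then show ?thesis by (simp only: power_mult_distrib of_real_power[symmetric])
  qed
  have 4: "- of_real \<delta> * (of_real (sqrt (y / 2)) * s) = - (of_real (\<delta> * sqrt (y / 2)) * s)" by simp
  have 5: "(s\<^sup>2 - 1) powr of_real (- (n/2)) = 1 / (s\<^sup>2 - 1) powr of_real (n/2)"
    unfolding of_real_minus powr_minus by (rule inverse_eq_divide)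
  have "2 * s * (e * (b * r) / d) = e * r * (2 * (s * b) * (1 / d))" for b d e r :: complex
    by simp
  then show ?thesis
    unfolding nct_kernel_def beta_kernel_def erfc_kernel_def Let_def 2 3 4 5 1[symmetric] .
next
  case True
  then have "beta_kernel (1/2) (n/2) s = 0" by (simp add: beta_kernel_def)
  with True show ?thesis by (simp only: mult_zero_left mult_zero_right)
qed

lemma holomorphic_nct_kernel:
  assumes "0 < y"
  shows "nct_kernel n \<delta> y holomorphic_on slit_plane"
proof -
  have 1: "z \<notin> \<real>\<^sub>\<le>\<^sub>0" "z - 1 \<notin> \<real>\<^sub>\<le>\<^sub>0" "of_real (y / 2) * z \<notin> \<real>\<^sub>\<le>\<^sub>0" if "z \<in> slit_plane" for z
    using that assms by (auto simp: slit_plane_def complex_nonpos_Reals_iff mult_le_0_iff)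
  then have 2: "(z - 1) powr c \<noteq> 0" if "z \<in> slit_plane" for z c
    using that by force
  have "(\<lambda>z. csqrt (of_real (y / 2) * z)) holomorphic_on slit_plane"
    using 1 by (intro holomorphic_on_csqrt' holomorphic_intros) auto
  then have "(\<lambda>z. erfc (- of_real \<delta> * csqrt (of_real (y / 2) * z))) holomorphic_on slit_plane"
    by (intro holomorphic_on_compose_gen[OF _ holomorphic_erfc, unfolded o_def]
        holomorphic_on_mult holomorphic_on_const) auto
  then show ?thesis
    unfolding nct_kernel_def using 1 2 by (intro holomorphic_intros) auto
qed

lemma tendsto_nct_kernel_square:
  assumes "0 < n" "0 < y"
  shows "((\<lambda>s. s * nct_kernel n \<delta> y (s\<^sup>2)) \<longlongrightarrow> 0) (at 0 within slit_halfplane)"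
proof -
  have "(beta_kernel (1/2) (n/2) \<longlongrightarrow> 2 * 0) (at 0 within slit_halfplane)"
    unfolding beta_kernel_def mult.assoc
    by (intro tendsto_mult_left tendsto_within_subset[OF tendsto_powr_product_zero]) (use assms in auto)
  moreover have "isCont (erfc_kernel \<delta> y) 0"
    using holomorphic_erfc_kernel[of \<delta> y UNIV] holomorphic_on_imp_continuous_on continuous_on_eq_continuous_at by blast
  then have "(erfc_kernel \<delta> y \<longlongrightarrow> erfc_kernel \<delta> y 0) (at 0 within slit_halfplane)"
    by (simp add: isCont_def tendsto_within_subset[where S = UNIV])
  ultimately have "((\<lambda>s. 1/2 * (erfc_kernel \<delta> y s * beta_kernel (1/2) (n/2) s)) \<longlongrightarrow> 1/2 * (erfc_kernel \<delta> y 0 * (2 * 0)))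
      (at 0 within slit_halfplane)"
    by (intro tendsto_mult tendsto_const)
  moreover have "1/2 * (erfc_kernel \<delta> y s * beta_kernel (1/2) (n/2) s) = s * nct_kernel n \<delta> y (s\<^sup>2)" if "s \<in> slit_halfplane" for s
    using nct_kernel_square[of s y n \<delta>] that assms by (simp flip: nct_kernel_square)
  then have "\<forall>\<^sub>F s in at 0 within slit_halfplane. 1/2 * (erfc_kernel \<delta> y s * beta_kernel (1/2) (n/2) s) = s * nct_kernel n \<delta> y (s\<^sup>2)"
    unfolding eventually_at_filter by (intro always_eventually) blast
  ultimately show ?thesis
    using Lim_transform_eventually by fastforce
qed

text \<open>The divided difference \<open>f\<close> of the kernel at \<open>1/y\<close> has no pole,
  so its integral may be moved from \<open>\<gamma>\<close> to the triangle. The pole part stays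
  behind on \<open>\<gamma>\<close>, where it yields the winding number.\<close>

lemma has_contour_integral_nct_loop:
  assumes n: "0 < n" and y: "0 < y" "y < 1" and w: "1 < Re w" "0 < Im w" and yw: "y * (cmod w)\<^sup>2 < 1"
    and \<gamma>: "loop_around_1 \<gamma>" and pole: "complex_of_real (1/y) \<notin> path_image \<gamma>"
  shows "((\<lambda>\<tau>. nct_kernel n \<delta> y \<tau> / (1 - of_real y * \<tau>)) has_contour_integral
     (contour_integral (triangle_path w) (\<lambda>s. erfc_kernel \<delta> y s * beta_kernel (1/2) (n/2) s / (1 - of_real y * s\<^sup>2))
      - nct_kernel n \<delta> y (of_real (1/y)) / of_real y * (2 * of_real pi * \<i> * winding_number \<gamma> (of_real (1/y))))) \<gamma>"
proof -
  let ?P = "path_image (triangle_path w)"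
  define k where "k = nct_kernel n \<delta> y"
  define a where "a = complex_of_real (1/y)"
  define f where "f = (\<lambda>z. if z = a then deriv k a else (k z - k a) / (z - a))"
  define X where "X = contour_integral (triangle_path w)
    (\<lambda>s. erfc_kernel \<delta> y s * beta_kernel (1/2) (n/2) s / (1 - of_real y * s\<^sup>2))"
  have P: "?P \<subseteq> insert 0 slit_halfplane" by (rule path_image_triangle_path_subset[OF w])
  have y0: "complex_of_real y \<noteq> 0" using y by simp
  have a: "a \<in> slit_plane" "a \<noteq> 0" "of_real y * a = 1" using y by (auto simp: a_def slit_plane_def)
  have f: "f holomorphic_on slit_plane"
    unfolding f_def k_def
    by (rule pole_lemma) (use a holomorphic_nct_kernel y open_slit_plane in \<open>auto simp: interior_open\<close>)
  have "((\<lambda>s. s * f (s\<^sup>2)) \<longlongrightarrow> 0) (at 0 within slit_halfplane)"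
  proof -
    have "((\<lambda>s. (s * k (s\<^sup>2) - s * k a) / (s\<^sup>2 - a)) \<longlongrightarrow> (0 - 0 * k a) / (0\<^sup>2 - a)) (at 0 within slit_halfplane)"
      using tendsto_nct_kernel_square[OF n y(1), of \<delta>] a
      by (intro tendsto_intros) (auto simp: k_def)
    moreover have "isCont (\<lambda>s::complex. s\<^sup>2) 0" by (intro continuous_intros)
    then have "\<forall>\<^sub>F s in at 0 within slit_halfplane. s\<^sup>2 \<noteq> a"
      using a tendsto_imp_eventually_ne[of "\<lambda>s. s\<^sup>2" 0 "at 0 within slit_halfplane" a]
      by (simp add: isCont_def tendsto_within_subset[where S = UNIV])
    then have "\<forall>\<^sub>F s in at 0 within slit_halfplane. (s * k (s\<^sup>2) - s * k a) / (s\<^sup>2 - a) = s * f (s\<^sup>2)"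
      by eventually_elim (simp add: f_def right_diff_distrib)
    ultimately show ?thesis
      using Lim_transform_eventually by fastforce
  qed
  from has_contour_integral_loop[OF f this w \<gamma>] obtain I where
    I: "(f has_contour_integral I) \<gamma>" "((\<lambda>s. 2 * s * f (s\<^sup>2)) has_contour_integral I) (triangle_path w)" .
  have small: "cmod (of_real y * s\<^sup>2) < 1" if "cmod s \<le> cmod w" for s
  proof -
    have "cmod (of_real y * s\<^sup>2) \<le> y * (cmod w)\<^sup>2"
      using that y by (auto simp: norm_mult norm_power intro!: mult_left_mono power_mono)
    then show ?thesis using yw by linarith
  qed
  have ne: "1 - of_real y * s\<^sup>2 \<noteq> 0" if "cmod s \<le> cmod w" for s
    using small[OF that] by (metis eq_iff_diff_eq_0 less_irrefl norm_one)
  have nP: "cmod s \<le> cmod w" if "s \<in> ?P" for s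
    using that by (rule norm_path_image_triangle_path)
  have I_eq: "I = - of_real y * X"
  proof -
    \<comment> \<open>On the triangle the subtracted pole part contributes nothing:
      \<open>y * (cmod w)^2 < 1\<close> keeps both of its poles outside the disc
      \<open>cball 0 (cmod w)\<close>.\<close>
    have "((\<lambda>s. 2 * s / (1 - of_real y * s\<^sup>2)) has_contour_integral 0) (triangle_path w)"
    proof (rule Cauchy_theorem_convex_simple)
      show "(\<lambda>s. 2 * s / (1 - of_real y * s\<^sup>2)) holomorphic_on cball 0 (cmod w)"
        using ne by (intro holomorphic_intros) auto
    qed (use nP in auto)
    moreover have "continuous_on ?P (\<lambda>s. erfc_kernel \<delta> y s * beta_kernel (1/2) (n/2) s / (1 - of_real y * s\<^sup>2))"
      using n nP ne
      by (intro continuous_intros continuous_on_subset[OF continuous_on_beta_kernel P]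
          holomorphic_on_imp_continuous_on holomorphic_erfc_kernel) auto
    then have "((\<lambda>s. erfc_kernel \<delta> y s * beta_kernel (1/2) (n/2) s / (1 - of_real y * s\<^sup>2)) has_contour_integral X) (triangle_path w)"
      unfolding X_def by (intro has_contour_integral_integral contour_integrable_triangle_path)
    ultimately have "((\<lambda>s. - of_real y * (erfc_kernel \<delta> y s * beta_kernel (1/2) (n/2) s / (1 - of_real y * s\<^sup>2))
       + of_real y * k a * (2 * s / (1 - of_real y * s\<^sup>2))) has_contour_integral (- of_real y * X + of_real y * k a * 0)) (triangle_path w)"
      by (intro has_contour_integral_add has_contour_integral_lmul)
    moreover have "- of_real y * (erfc_kernel \<delta> y s * beta_kernel (1/2) (n/2) s / (1 - of_real y * s\<^sup>2))
       + of_real y * k a * (2 * s / (1 - of_real y * s\<^sup>2)) = 2 * s * f (s\<^sup>2)" if "s \<in> ?P" for s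
    proof -
      have d: "1 - of_real y * s\<^sup>2 \<noteq> 0" using ne nP that by blast
      have e: "s\<^sup>2 - a = - ((1 - of_real y * s\<^sup>2) / of_real y)"
        using y0 by (simp add: a_def field_simps)
      then have "s\<^sup>2 \<noteq> a" using d y0 by auto
      then have "2 * s * f (s\<^sup>2) = (2 * s * k (s\<^sup>2) - 2 * s * k a) / (s\<^sup>2 - a)"
        by (simp add: f_def right_diff_distrib)
      also have "2 * s * k (s\<^sup>2) = erfc_kernel \<delta> y s * beta_kernel (1/2) (n/2) s"
        unfolding k_def by (rule nct_kernel_square) (use P that y in auto)
      finally have eq: "2 * s * f (s\<^sup>2) =
          (erfc_kernel \<delta> y s * beta_kernel (1/2) (n/2) s - 2 * s * k a) / (s\<^sup>2 - a)" .
      show ?thesis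
        unfolding eq e using d y0 by (simp add: divide_simps) (simp add: algebra_simps)
    qed
    ultimately have "((\<lambda>s. 2 * s * f (s\<^sup>2)) has_contour_integral (- of_real y * X + of_real y * k a * 0)) (triangle_path w)"
      by (rule has_contour_integral_eq)
    then show ?thesis
      using I(2) has_contour_integral_unique by fastforce
  qed
  have "valid_path \<gamma>" using \<gamma> by (simp add: loop_around_1_def)
  then have "((\<lambda>\<tau>. 1 / (\<tau> - a)) has_contour_integral (2 * of_real pi * \<i> * winding_number \<gamma> a)) \<gamma>"
    using has_contour_integral_winding_number[of \<gamma> a] pole by (simp add: a_def)
  then have int: "((\<lambda>\<tau>. - (1 / of_real y) * f \<tau> + - (k a / of_real y) * (1 / (\<tau> - a))) has_contour_integral
      (- (1 / of_real y) * I + - (k a / of_real y) * (2 * of_real pi * \<i> * winding_number \<gamma> a))) \<gamma>"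
    by (intro has_contour_integral_add has_contour_integral_lmul I(1))
  have eq: "- (1 / of_real y) * f \<tau> + - (k a / of_real y) * (1 / (\<tau> - a)) = k \<tau> / (1 - of_real y * \<tau>)"
    if "\<tau> \<in> path_image \<gamma>" for \<tau>
  proof -
    have "\<tau> \<noteq> a" using that pole by (auto simp: a_def)
    have "- (1 / of_real y) * f \<tau> + - (k a / of_real y) * (1 / (\<tau> - a)) = - (k \<tau> / (of_real y * (\<tau> - a)))"
      using \<open>\<tau> \<noteq> a\<close> y0 by (simp add: f_def field_simps)
    also have "of_real y * (\<tau> - a) = - (1 - of_real y * \<tau>)"
      using a(3) by (simp add: algebra_simps)
    finally show ?thesis by (simp only: divide_minus_right minus_minus)
  qed
  show ?thesis
    using has_contour_integral_eq[OF int eq] y0 unfolding I_eq by (simp add: k_def a_def X_def)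
qed

section \<open>Identification of the two series and of the residue\<close>

lemma suminf_of_real_eq:
  assumes "(\<lambda>j. complex_of_real (f j)) sums c"
  shows "complex_of_real (suminf f) = c"
proof -
  \<comment> \<open>Taking real parts gives convergence of the real series, so
    \<open>suminf f\<close> is a genuine sum.\<close>
  have "summable f" using sums_Re[OF assms] by (auto simp: sums_iff)
  then show ?thesis using assms sums_of_real[OF summable_sums] sums_unique2 by blast
qed

text \<open>By \<open>erfc_minus_eq\<close>, \<open>erfc_kernel\<close> splits into
  \<open>exp (z^2)\<close> and \<open>z\<close> times a series in \<open>z^2\<close>. The first part
  keeps \<open>p = 1/2\<close>; in the second the additional factor \<open>s\<close> moves the beta
  kernel to \<open>p = 1\<close>.\<close>

lemma nct_sum_contour_integral:
  assumes n: "0 < n" and y: "0 < y" "y < 1" and w: "1 < Re w" "0 < Im w" and yw: "y * (cmod w)\<^sup>2 < 1"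
  defines "c \<equiv> complex_of_real (sqrt y * (1 - y) powr (n/2)) / (2 * of_real pi * \<i>)"
  shows "complex_of_real ((\<Sum>j. (\<delta>\<^sup>2 / 2) ^ j / fact j * inc_beta y (real j + 1/2) (n/2)) +
      (\<Sum>j. \<delta> / sqrt 2 * ((\<delta>\<^sup>2 / 2) ^ j / Gamma (real j + 3/2)) * inc_beta y (real j + 1) (n/2))) =
    c * contour_integral (triangle_path w)
      (\<lambda>s. erfc_kernel \<delta> y s * beta_kernel (1/2) (n/2) s / (1 - of_real y * s\<^sup>2))"
proof -
  let ?P = "path_image (triangle_path w)"
  define \<zeta> where "\<zeta> = (\<lambda>s. of_real (\<delta> * sqrt (y / 2)) * s :: complex)"
  define v where "v = (\<lambda>s. (\<zeta> s)\<^sup>2)"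
  define g where "g = (\<lambda>p s. beta_kernel p (n/2) s / (1 - of_real y * s\<^sup>2))"
  define r where "r = cmod (of_real (\<delta> * sqrt (y / 2)) * w) ^ 2"
  have P: "?P \<subseteq> insert 0 slit_halfplane" by (rule path_image_triangle_path_subset[OF w])
  have ne: "1 - of_real y * s\<^sup>2 \<noteq> 0" if "s \<in> ?P" for s
  proof
    assume "1 - of_real y * s\<^sup>2 = 0"
    then have "cmod (of_real y * s\<^sup>2) = 1" by (metis eq_iff_diff_eq_0 norm_one)
    moreover have "cmod (of_real y * s\<^sup>2) \<le> y * (cmod w)\<^sup>2"
      using norm_path_image_triangle_path[OF that] y
      by (auto simp: norm_mult norm_power intro!: mult_left_mono power_mono)
    ultimately show False using yw by linarith
  qed
  have contg: "continuous_on ?P (g p)" if "1/2 \<le> p" for p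
    unfolding g_def using ne n that
    by (intro continuous_intros continuous_on_subset[OF continuous_on_beta_kernel P])
      auto
  have contv: "continuous_on ?P v"
    unfolding v_def \<zeta>_def by (intro continuous_intros)
  have bv: "cmod (v s) \<le> r" if "s \<in> ?P" for s
    unfolding v_def \<zeta>_def r_def norm_power norm_mult
    using norm_path_image_triangle_path[OF that] by (intro power_mono mult_left_mono) auto
  have v_eq: "v s = of_real (\<delta>\<^sup>2 / 2) * of_real y * s\<^sup>2" for s
  proof -
    have "(\<delta> * sqrt (y / 2))\<^sup>2 = \<delta>\<^sup>2 / 2 * y"
      using y by (simp add: power_mult_distrib)
    then show ?thesis
      unfolding v_def \<zeta>_def by (simp only: power_mult_distrib of_real_power[symmetric] of_real_mult[symmetric])
  qed
  have sm1: "summable (\<lambda>j. cmod (1 / fact j) * r ^ j)"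
    using summable_exp[of r] by (simp add: norm_inverse divide_inverse)
  have sm2: "summable (\<lambda>j. cmod (1 / of_real (Gamma (real j + 3/2))) * r ^ j)"
  proof -
    have "0 \<le> r" by (simp add: r_def)
    \<comment> \<open>Absolute convergence at \<open>r\<close> is deduced from convergence at a
      point of strictly larger modulus.\<close>
    have "summable (\<lambda>j. 1 / of_real (Gamma (real j + 3/2)) * complex_of_real (r + 1) ^ j)"
      using summable_odd_erfc_series[of "of_real (r + 1)"] by simp
    moreover have "norm (complex_of_real r) < norm (complex_of_real (r + 1))"
      using \<open>0 \<le> r\<close> by (simp del: of_real_add)
    ultimately have "summable (\<lambda>j. norm (1 / of_real (Gamma (real j + 3/2)) * complex_of_real r ^ j))"
      by (rule powser_insidea)
    then show ?thesis using \<open>0 \<le> r\<close> by (simp add: norm_mult norm_power norm_divide)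
  qed
  \<comment> \<open>The constant \<open>c\<close> carries \<open>sqrt y\<close> where the beta
    integral wants \<open>y powr p\<close>. Their quotient is \<open>1\<close> for
    \<open>p = 1/2\<close>; for \<open>p = 1\<close> it is \<open>1 / sqrt y\<close>, which cancels
    against the factor \<open>sqrt (y / 2)\<close> of \<open>\<zeta>\<close>.\<close>
  have term_eq: "c * contour_integral (triangle_path w) (\<lambda>s. g p s * v s ^ j) =
      of_real ((\<delta>\<^sup>2 / 2) ^ j * (sqrt y / y powr p) * inc_beta y (p + real j) (n/2))" if p: "1/2 \<le> p" for p j
  proof -
    have "contour_integral (triangle_path w) (\<lambda>s. g p s * v s ^ j) =
      contour_integral (triangle_path w) (\<lambda>s. of_real ((\<delta>\<^sup>2 / 2) ^ j * y ^ j) * g (p + real j) s)"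
    proof (rule contour_integral_cong[OF refl])
      fix s assume "s \<in> ?P"
      then have b: "beta_kernel (p + real j) (n/2) s = s ^ (2 * j) * beta_kernel p (n/2) s"
        using P by (intro beta_kernel_add_nat) auto
      have vj: "v s ^ j = of_real ((\<delta>\<^sup>2 / 2) ^ j * y ^ j) * s ^ (2 * j)"
        unfolding v_eq by (simp only: power_mult_distrib power_mult of_real_mult of_real_power)
      show "g p s * v s ^ j = of_real ((\<delta>\<^sup>2 / 2) ^ j * y ^ j) * g (p + real j) s"
        unfolding g_def b vj by (simp only: mult_ac times_divide_eq_left times_divide_eq_right)
    qed
    also have "\<dots> = of_real ((\<delta>\<^sup>2 / 2) ^ j * y ^ j) * contour_integral (triangle_path w) (g (p + real j))"
      by (rule contour_integral_lmul[OF contour_integrable_triangle_path[OF contg]]) (use p in simp)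
    finally have 1: "contour_integral (triangle_path w) (\<lambda>s. g p s * v s ^ j) =
      of_real ((\<delta>\<^sup>2 / 2) ^ j * y ^ j) * contour_integral (triangle_path w) (g (p + real j))" .
    have 2: "complex_of_real (inc_beta y (p + real j) (n/2)) =
       of_real (y powr (p + real j) * (1 - y) powr (n/2)) / (2 * of_real pi * \<i>) * contour_integral (triangle_path w) (g (p + real j))"
      unfolding g_def by (rule inc_beta_contour_integral[OF w _ _ _ y yw]) (use p n in auto)
    have "y powr (p + real j) = y powr p * y ^ j" "y powr p \<noteq> 0" using y by (simp_all add: powr_add powr_realpow)
    then show ?thesis unfolding 1 of_real_mult 2 c_def by simp
  qed
  define A where "A = (\<lambda>s. g (1/2) s * (\<Sum>j. 1 / fact j * v s ^ j))"
  define B where "B = (\<lambda>s. g 1 s * (\<Sum>j. 1 / of_real (Gamma (real j + 3/2)) * v s ^ j))"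
  have A: "(\<lambda>j. 1 / fact j * contour_integral (triangle_path w) (\<lambda>s. g (1/2) s * v s ^ j)) sums
      contour_integral (triangle_path w) A" "continuous_on ?P A"
    unfolding A_def by (rule contour_integral_triangle_path_sums[OF contg contv bv sm1]; simp)+
  have B: "(\<lambda>j. 1 / of_real (Gamma (real j + 3/2)) * contour_integral (triangle_path w) (\<lambda>s. g 1 s * v s ^ j)) sums
      contour_integral (triangle_path w) B" "continuous_on ?P B"
    unfolding B_def by (rule contour_integral_triangle_path_sums[OF contg contv bv sm2]; simp)+
  have 1: "complex_of_real (\<Sum>j. (\<delta>\<^sup>2 / 2) ^ j / fact j * inc_beta y (real j + 1/2) (n/2)) =
      c * contour_integral (triangle_path w) A"
  proof (rule suminf_of_real_eq)
    have "c * (1 / fact j * contour_integral (triangle_path w) (\<lambda>s. g (1/2) s * v s ^ j)) =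
       complex_of_real ((\<delta>\<^sup>2 / 2) ^ j / fact j * inc_beta y (real j + 1/2) (n/2))" for j
    proof -
      have "c * (1 / fact j * contour_integral (triangle_path w) (\<lambda>s. g (1/2) s * v s ^ j)) =
        1 / fact j * (c * contour_integral (triangle_path w) (\<lambda>s. g (1/2) s * v s ^ j))" by simp
      also have "\<dots> = of_real (1 / fact j * ((\<delta>\<^sup>2 / 2) ^ j * (sqrt y / y powr (1/2)) * inc_beta y (1/2 + real j) (n/2)))"
        by (subst term_eq) simp_all
      finally show ?thesis using y by (simp add: powr_half_sqrt add.commute)
    qed
    then show "(\<lambda>j. complex_of_real ((\<delta>\<^sup>2 / 2) ^ j / fact j * inc_beta y (real j + 1/2) (n/2))) sums
      (c * contour_integral (triangle_path w) A)"
      using sums_mult[OF A(1), of c] by (simp only:)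
  qed
  have 2: "complex_of_real (\<Sum>j. \<delta> / sqrt 2 * ((\<delta>\<^sup>2 / 2) ^ j / Gamma (real j + 3/2)) * inc_beta y (real j + 1) (n/2)) =
      c * of_real (\<delta> * sqrt (y / 2)) * contour_integral (triangle_path w) B"
  proof (rule suminf_of_real_eq)
    have "c * of_real (\<delta> * sqrt (y / 2)) * (1 / of_real (Gamma (real j + 3/2)) * contour_integral (triangle_path w) (\<lambda>s. g 1 s * v s ^ j)) =
       complex_of_real (\<delta> / sqrt 2 * ((\<delta>\<^sup>2 / 2) ^ j / Gamma (real j + 3/2)) * inc_beta y (real j + 1) (n/2))" for j
    proof -
      have "c * of_real (\<delta> * sqrt (y / 2)) * (1 / of_real (Gamma (real j + 3/2)) * contour_integral (triangle_path w) (\<lambda>s. g 1 s * v s ^ j)) =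
        of_real (\<delta> * sqrt (y / 2) / Gamma (real j + 3/2)) * (c * contour_integral (triangle_path w) (\<lambda>s. g 1 s * v s ^ j))" by simp
      also have "\<dots> = of_real (\<delta> * sqrt (y / 2) / Gamma (real j + 3/2) * ((\<delta>\<^sup>2 / 2) ^ j * (sqrt y / y powr 1) * inc_beta y (1 + real j) (n/2)))"
        by (subst term_eq) simp_all
      also have "\<delta> * sqrt (y / 2) / Gamma (real j + 3/2) * ((\<delta>\<^sup>2 / 2) ^ j * (sqrt y / y powr 1) * inc_beta y (1 + real j) (n/2)) =
        \<delta> * (sqrt (y / 2) * (sqrt y / y powr 1)) * ((\<delta>\<^sup>2 / 2) ^ j / Gamma (real j + 3/2)) * inc_beta y (real j + 1) (n/2)"
        by (simp only: mult_ac add.commute times_divide_eq_left times_divide_eq_right divide_divide_eq_left)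
      also have "sqrt (y / 2) * (sqrt y / y powr 1) = 1 / sqrt 2"
        using y by (simp add: real_sqrt_divide)
      finally show ?thesis by (simp only: mult_1_right times_divide_eq_right)
    qed
    then show "(\<lambda>j. complex_of_real (\<delta> / sqrt 2 * ((\<delta>\<^sup>2 / 2) ^ j / Gamma (real j + 3/2)) * inc_beta y (real j + 1) (n/2))) sums
      (c * of_real (\<delta> * sqrt (y / 2)) * contour_integral (triangle_path w) B)"
      using sums_mult[OF B(1), of "c * of_real (\<delta> * sqrt (y / 2))"] by (simp only:)
  qed
  have "contour_integral (triangle_path w)
      (\<lambda>s. erfc_kernel \<delta> y s * beta_kernel (1/2) (n/2) s / (1 - of_real y * s\<^sup>2)) =
    contour_integral (triangle_path w) (\<lambda>s. A s + of_real (\<delta> * sqrt (y / 2)) * B s)"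
  proof (rule contour_integral_cong[OF refl])
    fix s assume s: "s \<in> ?P"
    have E1: "erfc_kernel \<delta> y s = exp (v s) + \<zeta> s * (\<Sum>j. v s ^ j / of_real (Gamma (real j + 3/2)))"
      unfolding erfc_kernel_def Let_def \<zeta>_def[symmetric] v_def erfc_minus_eq[of "\<zeta> s"]
      by (simp add: distrib_left exp_minus)
    have E2: "(\<Sum>j. 1 / fact j * v s ^ j) = exp (v s)"
      by (simp add: exp_def scaleR_conv_of_real divide_inverse mult.commute)
    have E3: "s * beta_kernel (1/2) (n/2) s = beta_kernel 1 (n/2) s"
    proof (cases "s = 0")
      case False
      then have "s * s powr of_real (2 * (1/2 + n/2) - 1) = s powr (1 + of_real (2 * (1/2 + n/2) - 1))"
        using powr_add[of s 1] by simp
      then have e: "s * s powr of_real (2 * (1/2 + n/2) - 1) = s powr of_real (2 * (1 + n/2) - 1)"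
        by (simp add: algebra_simps)
      show ?thesis unfolding beta_kernel_def e[symmetric] by (simp only: mult_ac)
    qed (simp add: beta_kernel_def)
    have E4: "(\<Sum>j. 1 / complex_of_real (Gamma (real j + 3/2)) * v s ^ j) = (\<Sum>j. v s ^ j / of_real (Gamma (real j + 3/2)))"
      by simp
    show "erfc_kernel \<delta> y s * beta_kernel (1/2) (n/2) s / (1 - of_real y * s\<^sup>2) =
       A s + of_real (\<delta> * sqrt (y / 2)) * B s"
      unfolding A_def B_def g_def E1 E2 E4 E3[symmetric] \<zeta>_def
      by (simp only: distrib_left distrib_right add_divide_distrib times_divide_eq_left times_divide_eq_right mult_ac)
  qed
  also have "\<dots> = contour_integral (triangle_path w) A + of_real (\<delta> * sqrt (y / 2)) * contour_integral (triangle_path w) B"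
  proof (rule contour_integral_unique, rule has_contour_integral_add)
    show "(A has_contour_integral contour_integral (triangle_path w) A) (triangle_path w)"
      by (intro has_contour_integral_integral contour_integrable_triangle_path A(2))
    show "((\<lambda>s. of_real (\<delta> * sqrt (y / 2)) * B s) has_contour_integral
        of_real (\<delta> * sqrt (y / 2)) * contour_integral (triangle_path w) B) (triangle_path w)"
      by (rule has_contour_integral_lmul[OF has_contour_integral_integral[OF contour_integrable_triangle_path[OF B(2)]]])
  qed
  finally show ?thesis
    using 1 2 by (simp add: distrib_left mult.assoc)
qed

text \<open>Evaluation at \<open>s = 1 / sqrt y > 1\<close>, where every base is positive and all
  powers are real, reduces the residue to the two kernels; the powers of \<open>y\<close> and
  \<open>1 - y\<close> cancel.\<close>

lemma nct_kernel_at_pole: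
  assumes y: "0 < y" "y < 1"
  shows "nct_kernel n \<delta> y (of_real (1/y)) / of_real y * of_real (sqrt y * (1 - y) powr (n/2)) =
    of_real (exp (\<delta>\<^sup>2 / 2) * erfc (- (\<delta> / sqrt 2)))"
proof -
  define x where "x = 1 / sqrt y"
  define s where "s = complex_of_real x"
  have x: "1 < x" "x\<^sup>2 = 1 / y" using y by (auto simp: x_def power_divide)
  have s: "s \<in> slit_halfplane" "s\<^sup>2 = of_real (1/y)"
    using x by (auto simp: s_def slit_halfplane_def simp flip: of_real_power)
  have "\<delta> * sqrt (y / 2) * x = \<delta> / sqrt 2" using y by (simp add: x_def real_sqrt_divide)
  then have "of_real (\<delta> * sqrt (y / 2)) * s = of_real (\<delta> / sqrt 2)"
    unfolding s_def of_real_mult[symmetric] by simp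
  then have "erfc_kernel \<delta> y s = exp ((of_real (\<delta> / sqrt 2))\<^sup>2) * erfc (- of_real (\<delta> / sqrt 2))"
    by (simp only: erfc_kernel_def Let_def)
  also have "\<dots> = of_real (exp (\<delta>\<^sup>2 / 2) * erfc (- (\<delta> / sqrt 2)))"
  proof -
    have "(complex_of_real (\<delta> / sqrt 2))\<^sup>2 = of_real (\<delta>\<^sup>2 / 2)"
      unfolding of_real_power[symmetric] by (simp add: power_divide)
    then show ?thesis
      by (simp only: of_real_mult of_real_erfc of_real_minus exp_of_real)
  qed
  finally have E: "erfc_kernel \<delta> y s = of_real (exp (\<delta>\<^sup>2 / 2) * erfc (- (\<delta> / sqrt 2)))" .
  have B: "beta_kernel (1/2) (n/2) s = of_real (2 * (1 - y) powr (- (n/2)))"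
  proof -
    have 1: "s powr of_real (2 * (1/2 + n/2) - 1) = of_real (x powr n)"
      using x unfolding s_def by (subst powr_of_real) auto
    have 2: "(s\<^sup>2 - 1) powr of_real (- (n/2)) = of_real ((1/y - 1) powr (- (n/2)))"
      using y powr_of_real[of "1/y - 1" "- (n/2)"] unfolding s(2) by simp
    have 3: "x powr n * (1/y - 1) powr (- (n/2)) = (1 - y) powr (- (n/2))"
    proof -
      have "x powr n = (x powr 2) powr (n/2)" by (simp add: powr_powr del: powr_numeral)
      also have "\<dots> = (1/y) powr (n/2)" using x by simp
      finally have "x powr n = (1/y) powr (n/2)" .
      moreover have "(1/y - 1) powr (- (n/2)) = ((1 - y) * (1/y)) powr (- (n/2))"
        using y by (simp add: field_simps)
      moreover have "\<dots> = (1 - y) powr (- (n/2)) * (1/y) powr (- (n/2))"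
        by (rule powr_mult)
      ultimately show ?thesis using y by (simp add: powr_minus)
    qed
    show ?thesis
      unfolding beta_kernel_def 1 2 3[symmetric] by (simp only: of_real_mult of_real_numeral mult.assoc)
  qed
  have "2 * s * nct_kernel n \<delta> y (of_real (1/y)) =
      of_real (exp (\<delta>\<^sup>2 / 2) * erfc (- (\<delta> / sqrt 2))) * of_real (2 * (1 - y) powr (- (n/2)))"
    using nct_kernel_square[of s y n \<delta>] s y unfolding E B by simp
  moreover have "s = 1 / of_real (sqrt y)" by (simp add: s_def x_def)
  ultimately have "nct_kernel n \<delta> y (of_real (1/y)) =
      of_real (sqrt y * (exp (\<delta>\<^sup>2 / 2) * erfc (- (\<delta> / sqrt 2)) * (1 - y) powr (- (n/2))))"
    using y by (simp add: field_simps)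
  then have "nct_kernel n \<delta> y (of_real (1/y)) / of_real y * of_real (sqrt y * (1 - y) powr (n/2)) =
      of_real (sqrt y * (exp (\<delta>\<^sup>2 / 2) * erfc (- (\<delta> / sqrt 2)) * (1 - y) powr (- (n/2))) / y * (sqrt y * (1 - y) powr (n/2)))"
    by (simp only: of_real_mult of_real_divide)
  also have "sqrt y * (exp (\<delta>\<^sup>2 / 2) * erfc (- (\<delta> / sqrt 2)) * (1 - y) powr (- (n/2))) / y * (sqrt y * (1 - y) powr (n/2)) =
      exp (\<delta>\<^sup>2 / 2) * erfc (- (\<delta> / sqrt 2))"
    using y by (simp add: powr_minus field_simps)
  finally show ?thesis .
qed

theorem theorem3p5:
  fixes n x \<delta> y :: real
  assumes "n > 0" and "x > 0" and "y = x\<^sup>2 / (n + x\<^sup>2)"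
  shows "0 < y \<and> y < 1 \<and>
    (\<forall>\<gamma>. contour_1 y \<gamma> \<longrightarrow>
      (\<lambda>\<tau>. nct_kernel n \<delta> y \<tau> / (1 - of_real y * \<tau>)) contour_integrable_on \<gamma> \<and>
      complex_of_real (nct_F n x \<delta>) =
        of_real (1/2 * erfc (\<delta> / sqrt 2)) +
        of_real (1/2 * exp (- (\<delta>\<^sup>2 / 2))) *
        (of_real (sqrt y * (1 - y) powr (n/2)) / (2 * of_real pi * \<i>)) *
        contour_integral \<gamma> (\<lambda>\<tau>. nct_kernel n \<delta> y \<tau> / (1 - of_real y * \<tau>))) \<and>
    (\<forall>\<gamma>. contour_1_inv y \<gamma> \<longrightarrow>
      (\<lambda>\<tau>. nct_kernel n \<delta> y \<tau> / (of_real y * \<tau> - 1)) contour_integrable_on \<gamma> \<and>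
      complex_of_real (nct_F n x \<delta>) =
        1 -
        of_real (1/2 * exp (- (\<delta>\<^sup>2 / 2))) *
        (of_real (sqrt y * (1 - y) powr (n/2)) / (2 * of_real pi * \<i>)) *
        contour_integral \<gamma> (\<lambda>\<tau>. nct_kernel n \<delta> y \<tau> / (of_real y * \<tau> - 1)))"
proof -
  have y: "0 < y" "y < 1"
    using assms by (simp_all add: add_pos_pos)
  obtain w where w: "1 < Re w" "0 < Im w" and yw: "y * (cmod w)\<^sup>2 < 1"
  proof -
    \<comment> \<open>Half of the gap between \<open>1\<close> and \<open>1/y\<close>: the chosen
      \<open>w\<close> has squared modulus \<open>1 + 3/2 * d\<close>, below
      \<open>1 + 2 * d = 1/y\<close>, although \<open>Re w > 1\<close>.\<close>
    define d where "d = (1/y - 1) / 2"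
    have d: "0 < d" "1 + 2 * d = 1/y" using y by (auto simp: d_def field_simps)
    show ?thesis
    proof (rule that[of "Complex (sqrt (1 + d)) (sqrt (d/2))"])
      have "(cmod (Complex (sqrt (1 + d)) (sqrt (d/2))))\<^sup>2 = 1 + d + d/2"
        using d by (simp add: cmod_power2)
      also have "\<dots> < 1/y" using d by linarith
      finally show "y * (cmod (Complex (sqrt (1 + d)) (sqrt (d/2))))\<^sup>2 < 1"
        using y by (simp add: field_simps)
    qed (use d in auto)
  qed
  define X where "X = contour_integral (triangle_path w)
    (\<lambda>s. erfc_kernel \<delta> y s * beta_kernel (1/2) (n/2) s / (1 - of_real y * s\<^sup>2))"
  define c where "c = complex_of_real (sqrt y * (1 - y) powr (n/2)) / (2 * of_real pi * \<i>)"
  define h where "h = complex_of_real (1/2 * exp (- (\<delta>\<^sup>2 / 2)))"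
  define k where "k = nct_kernel n \<delta> y (of_real (1/y)) / of_real y * (2 * of_real pi * \<i>)"
  have "complex_of_real (nct_P n x \<delta> + nct_Q n x \<delta>) = h * (c * X)"
    unfolding X_def c_def nct_sum_contour_integral[OF assms(1) y w yw, symmetric]
    by (simp add: nct_P_def nct_Q_def Let_def assms(3)[symmetric] h_def distrib_left)
  then have F: "complex_of_real (nct_F n x \<delta>) = of_real (1/2 * erfc (\<delta> / sqrt 2)) + h * c * X"
    by (simp add: nct_F_def add.assoc mult.assoc)
  have loop: "((\<lambda>\<tau>. nct_kernel n \<delta> y \<tau> / (1 - of_real y * \<tau>)) has_contour_integral
     (X - k * winding_number \<gamma> (of_real (1/y)))) \<gamma>"
    if "loop_around_1 \<gamma>" "complex_of_real (1/y) \<notin> path_image \<gamma>" for \<gamma>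
    using has_contour_integral_nct_loop[OF assms(1) y w yw that, of \<delta>] by (simp only: X_def k_def mult.assoc)
  \<comment> \<open>The contribution of the pole is \<open>erfc (- (\<delta> / sqrt 2)) / 2\<close>.
    Reflection turns it into the difference between \<open>1\<close> and the leading term of the
    first formula.\<close>
  have "h * c * k = of_real (1/2 * erfc (- (\<delta> / sqrt 2)))"
  proof -
    have "h * c * k = h * (nct_kernel n \<delta> y (of_real (1/y)) / of_real y * of_real (sqrt y * (1 - y) powr (n/2)))"
    proof -
      have "u * (a / t) * (b * t) = u * (b * a)" if "t \<noteq> 0" for a b t u :: complex
        using that by simp
      from this[of "2 * of_real pi * \<i>"] show ?thesis unfolding c_def k_def by fastforce
    qed
    also have "\<dots> = of_real (1/2 * exp (- (\<delta>\<^sup>2 / 2)) * (exp (\<delta>\<^sup>2 / 2) * erfc (- (\<delta> / sqrt 2))))"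
      unfolding nct_kernel_at_pole[OF y] h_def by (simp only: of_real_mult)
    also have "1/2 * exp (- (\<delta>\<^sup>2 / 2)) * (exp (\<delta>\<^sup>2 / 2) * erfc (- (\<delta> / sqrt 2))) = 1/2 * erfc (- (\<delta> / sqrt 2))"
      by (simp add: exp_minus)
    finally show ?thesis .
  qed
  also have "\<dots> = 1 - of_real (1/2 * erfc (\<delta> / sqrt 2))"
    using erfc_reflect[of "of_real (\<delta> / sqrt 2)"]
    by (simp add: of_real_erfc field_simps)
  finally have res: "h * c * k = 1 - of_real (1/2 * erfc (\<delta> / sqrt 2))" .
  show ?thesis
    unfolding h_def[symmetric] c_def[symmetric]
  proof (intro conjI allI impI)
    show "0 < y" "y < 1" by (rule y)+
  next
    fix \<gamma> assume "contour_1 y \<gamma>"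
    then have I: "((\<lambda>\<tau>. nct_kernel n \<delta> y \<tau> / (1 - of_real y * \<tau>)) has_contour_integral X) \<gamma>"
      using loop[of \<gamma>] by (simp add: contour_1_def)
    then show "(\<lambda>\<tau>. nct_kernel n \<delta> y \<tau> / (1 - of_real y * \<tau>)) contour_integrable_on \<gamma>"
      by (auto simp: contour_integrable_on_def)
    show "complex_of_real (nct_F n x \<delta>) = of_real (1/2 * erfc (\<delta> / sqrt 2)) +
        h * c * contour_integral \<gamma> (\<lambda>\<tau>. nct_kernel n \<delta> y \<tau> / (1 - of_real y * \<tau>))"
      unfolding contour_integral_unique[OF I] by (rule F)
  next
    fix \<gamma> assume "contour_1_inv y \<gamma>"
    then have "((\<lambda>\<tau>. nct_kernel n \<delta> y \<tau> / (1 - of_real y * \<tau>)) has_contour_integral (X - k)) \<gamma>"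
      using loop[of \<gamma>] by (simp add: contour_1_inv_def)
    from has_contour_integral_neg[OF this]
    have I: "((\<lambda>\<tau>. nct_kernel n \<delta> y \<tau> / (of_real y * \<tau> - 1)) has_contour_integral (k - X)) \<gamma>"
      by (simp flip: divide_minus_right)
    then show "(\<lambda>\<tau>. nct_kernel n \<delta> y \<tau> / (of_real y * \<tau> - 1)) contour_integrable_on \<gamma>"
      by (auto simp: contour_integrable_on_def)
    have "h * c * (k - X) = (1 - of_real (1/2 * erfc (\<delta> / sqrt 2))) - h * c * X"
      by (simp only: right_diff_distrib res)
    then show "complex_of_real (nct_F n x \<delta>) =
        1 - h * c * contour_integral \<gamma> (\<lambda>\<tau>. nct_kernel n \<delta> y \<tau> / (of_real y * \<tau> - 1))"
      unfolding contour_integral_unique[OF I] F by (simp add: algebra_simps)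
  qed
qed

end
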